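(* Let $d\ge 1$ be an integer, $\delta>0$ and $1\le p<\infty$. Then the following statements are equivalent to each other. (i) The Bochner-Riesz mean $B_\delta$ is bounded on $L^p(\mathbb{R}^d)$. (ii) $(zI-B_\delta)^{-1}$ is bounded on $L^p(\mathbb{R}^d)$ for all $z\in\mathbb{C}\setminus[0,1]$. (iii) $(z_0I-B_\delta)^{-1}$ is bounded on $L^p(\mathbb{R}^d)$ for some $z_0\in\mathbb{C}\setminus[0,1]$.
   Context: Fourier transform: $\hat f(\xi)=\int_{\mathbb{R}^d} f(x)e^{-ix\cdot\xi}\,dx$ for integrable $f$, extended to tempered distributions as usual. For $t\in\mathbb{R}$, $t_+=\max(t,0)$. The Bochner-Riesz mean $B_\delta$ is the Fourier multiplier operator defined by $\widehat{B_\delta f}(\xi)=(1-|\xi|^2)_+^\delta\,\hat f(\xi)$. $I$ is the identity operator. For $z\in\mathbb{C}\setminus[0,1]$, $(zI-B_\delta)^{-1}$ denotes the Fourier multiplier operator with the bounded symbol $\big(z-(1-|\xi|^2)_+^\delta\big)^{-1}$. A multiplier operator $T$ with bounded symbol is said to be bounded on $L^p(\mathbb{R}^d)$ if there is a constant $C$ with $\|Tf\|_p\le C\|f\|_p$ for all Schwartz functions $f$ (so $T$ extends uniquely to a bounded operator on $L^p$). *)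

theory Defs
  imports "HOL-Analysis.Analysis"
begin

definition partial_deriv ::
    "'a::euclidean_space \<Rightarrow> ('a \<Rightarrow> complex) \<Rightarrow> 'a \<Rightarrow> complex" where
  "partial_deriv b f x = frechet_derivative f (at x) b"

primrec iter_partial ::
    "'a::euclidean_space list \<Rightarrow> ('a \<Rightarrow> complex) \<Rightarrow> 'a \<Rightarrow> complex" where
  "iter_partial [] f = f"
| "iter_partial (b # bs) f = partial_deriv b (iter_partial bs f)"

text \<open>
  A list of standard basis vectors plays the role of a multi-index. Since all iterated
  partial derivatives are required to be differentiable, \<open>frechet_derivative\<close> is only ever
  applied to differentiable functions, and the functions below are smooth.
\<close>

definition schwartz :: "('a::euclidean_space \<Rightarrow> complex) \<Rightarrow> bool" where
  "schwartz f \<longleftrightarrow>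
     (\<forall>bs\<in>lists Basis.
        iter_partial bs f differentiable_on UNIV \<and>
        (\<forall>k::nat. \<exists>C::real. \<forall>x. (1 + norm x) ^ k * norm (iter_partial bs f x) \<le> C))"

definition fourier :: "('a::euclidean_space \<Rightarrow> complex) \<Rightarrow> 'a \<Rightarrow> complex" where
  "fourier f \<xi> = (LINT x|lborel. f x * exp (- (\<i> * complex_of_real (x \<bullet> \<xi>))))"

definition inv_fourier :: "('a::euclidean_space \<Rightarrow> complex) \<Rightarrow> 'a \<Rightarrow> complex" where
  "inv_fourier g x =
     complex_of_real (1 / (2 * pi) ^ DIM('a)) *
     (LINT \<xi>|lborel. g \<xi> * exp (\<i> * complex_of_real (x \<bullet> \<xi>)))"

text \<open>
  The Fourier multiplier operator with bounded measurable symbol \<open>m\<close>, to be applied to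
  Schwartz functions \<open>f\<close>: then \<open>m \<cdot> fourier f\<close> is integrable, so the tempered distribution
  with this Fourier transform is the function given by the absolutely convergent integral.
\<close>

definition fourier_multiplier ::
    "('a::euclidean_space \<Rightarrow> complex) \<Rightarrow> ('a \<Rightarrow> complex) \<Rightarrow> 'a \<Rightarrow> complex" where
  "fourier_multiplier m f = inv_fourier (\<lambda>\<xi>. m \<xi> * fourier f \<xi>)"

definition Lp_norm :: "real \<Rightarrow> ('a::euclidean_space \<Rightarrow> complex) \<Rightarrow> ennreal" where
  "Lp_norm p f =
     (let I = (\<integral>\<^sup>+ x. ennreal (norm (f x) powr p) \<partial>lborel)
      in if I = \<infinity> then \<infinity> else ennreal (enn2real I powr (1 / p)))"

definition bounded_on_Lp ::
    "real \<Rightarrow> (('a::euclidean_space \<Rightarrow> complex) \<Rightarrow> 'a \<Rightarrow> complex) \<Rightarrow> bool" where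
  "bounded_on_Lp p T \<longleftrightarrow>
     (\<exists>C::real. 0 \<le> C \<and> (\<forall>f. schwartz f \<longrightarrow> Lp_norm p (T f) \<le> ennreal C * Lp_norm p f))"

text \<open>For \<open>\<delta> > 0\<close> the convention \<open>0 powr \<delta> = 0\<close> gives the value 0 outside the unit ball.\<close>

definition BR_symbol :: "real \<Rightarrow> 'a::euclidean_space \<Rightarrow> complex" where
  "BR_symbol \<delta> \<xi> = complex_of_real (max (1 - (norm \<xi>)\<^sup>2) 0 powr \<delta>)"

definition bochner_riesz ::
    "real \<Rightarrow> ('a::euclidean_space \<Rightarrow> complex) \<Rightarrow> 'a \<Rightarrow> complex" where
  "bochner_riesz \<delta> = fourier_multiplier (BR_symbol \<delta>)"

definition bochner_riesz_resolvent ::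
    "real \<Rightarrow> complex \<Rightarrow> ('a::euclidean_space \<Rightarrow> complex) \<Rightarrow> 'a \<Rightarrow> complex" where
  "bochner_riesz_resolvent \<delta> z = fourier_multiplier (\<lambda>\<xi>. inverse (z - BR_symbol \<delta> \<xi>))"

end

theory Submission
  imports Defs "HOL-Probability.Sinc_Integral" "HOL-Probability.Characteristic_Functions"
begin

text \<open>
  Write \<open>m\<close> for the Bochner-Riesz symbol and \<open>r = 1 / (z - m)\<close>. The bounded continuous symbols whose
  multipliers are bounded on \<open>L^p\<close> form a unital algebra. For \<open>n \<delta> > 2 d\<close> the symbols \<open>m^n r^j\<close> are
  compactly supported and so smooth that their kernels are integrable; hence they belong to the algebra
  whatever \<open>\<delta>\<close> and \<open>p\<close> are. Descending induction on \<open>n\<close> along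
  \<open>m^n r = (m^n + m^(n+1) r) / z\<close> puts \<open>r\<close> into the algebra if \<open>m\<close> is in it, and along
  \<open>m^(n+1) r^n = z (m r)^(n+1) - m^(n+2) r^(n+1)\<close>, where \<open>m r = z r - 1\<close>, it puts \<open>m\<close> into the
  algebra if \<open>r\<close> is in it.
\<close>

text \<open>A bounded symbol whose values stay away from 0 need not have an inverse among the L^p
  multipliers, so boundedness of r alone gives nothing. What helps is that m and r fail to be smooth
  at most on the unit sphere, and there m vanishes: a high power of m flattens the singularity,
  whatever power of r stands beside it. Both identities expand 1 = (z - m) r. The first keeps one
  factor r, because the powers of m are at hand; dividing by z is allowed since 0 lies in [0, 1]. In
  the second m is not at hand, only m r is, so every step must add a factor r along with a factor m.
  The threshold 2 d is the number of derivatives along each axis that bounds the kernel by the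
  product of the functions 1 / (1 + x_b^2). It may be crude, since n is free. Closure under products
  is not formal: boundedness is tested on Schwartz functions only, and a symbol that is merely
  continuous does not map them to Schwartz functions. The Gaussians serve to bridge this
  gap.\<close>

section \<open>Lebesgue integrals in coordinates and an integrable weight\<close>

lemma
  fixes f :: "'a::euclidean_space \<Rightarrow> real \<Rightarrow> 'b::{real_normed_field,banach,second_countable_topology}"
  assumes f: "\<And>b. b \<in> Basis \<Longrightarrow> integrable lborel (f b)"
  shows integrable_lborel_prod: "integrable lborel (\<lambda>x. \<Prod>b\<in>Basis. f b (x \<bullet> b))"
    and integral_lborel_prod:
      "(LINT x|lborel. (\<Prod>b\<in>Basis. f b (x \<bullet> b))) = (\<Prod>b\<in>Basis. LINT t|lborel. f b t)"
proof -
  interpret product_sigma_finite "\<lambda>b::'a. lborel :: real measure" ..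
  let ?g = "\<lambda>v::'a \<Rightarrow> real. \<Sum>b\<in>Basis. v b *\<^sub>R b"
  \<comment> \<open>Lebesgue measure is by construction the image of a product of one-dimensional
    measures, so the product theorem for integrals can be transported along
    \<open>?g\<close>.\<close>
  have lb: "lborel = distr (\<Pi>\<^sub>M b\<in>(Basis::'a set). lborel) borel ?g"
    by (subst lborel_def) (simp add: lborel_eq_real)
  have meas_f [measurable]: "f b \<in> borel_measurable borel" if "b \<in> Basis" for b
    using borel_measurable_integrable[OF f[OF that]] by simp
  have meas [measurable]: "(\<lambda>x. \<Prod>b\<in>Basis. f b (x \<bullet> b)) \<in> borel_measurable borel"
    by (intro borel_measurable_prod measurable_compose[OF _ meas_f]) auto
  have g [measurable]: "?g \<in> measurable (\<Pi>\<^sub>M b\<in>(Basis::'a set). lborel) borel"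
    by measurable
  have eq: "(\<Prod>b\<in>Basis. f b (?g v \<bullet> b)) = (\<Prod>b\<in>Basis. f b (v b))" for v
    by (intro prod.cong) auto
  show "integrable lborel (\<lambda>x. \<Prod>b\<in>Basis. f b (x \<bullet> b))"
    apply (subst lb)
    apply (subst integrable_distr_eq)
    using product_integrable_prod[of Basis f] f eq by auto
  show "(LINT x|lborel. (\<Prod>b\<in>Basis. f b (x \<bullet> b))) = (\<Prod>b\<in>Basis. LINT t|lborel. f b t)"
    apply (subst lb)
    apply (subst integral_distr)
    using product_integral_prod[of Basis f] f eq by auto
qed

lemma
  fixes f :: "'a::euclidean_space \<Rightarrow> 'b::{banach,second_countable_topology}"
  assumes c: "c \<noteq> (0::real)" and f: "integrable lborel f"
  shows integrable_lborel_affine: "integrable lborel (\<lambda>x. f (t + c *\<^sub>R x))"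
    and integral_lborel_affine:
      "(LINT x|lborel. f x) = \<bar>c\<bar> ^ DIM('a) *\<^sub>R (LINT x|lborel. f (t + c *\<^sub>R x))"
proof -
  have [measurable]: "f \<in> borel_measurable borel"
    using borel_measurable_integrable[OF f] by simp
  have lb: "lborel = density (distr lborel borel (\<lambda>x. t + c *\<^sub>R x)) (\<lambda>_. ennreal (\<bar>c\<bar>^DIM('a)))"
    using lborel_affine[OF c, of t] by (simp add: ennreal_power)
  have "integrable lborel (\<lambda>x. \<bar>c\<bar>^DIM('a) *\<^sub>R f (t + c *\<^sub>R x))"
    using f apply (subst (asm) lb)
    apply (subst (asm) integrable_density)
    by (auto simp: integrable_distr_eq)
  from integrable_scaleR_right[OF this, of "inverse (\<bar>c\<bar> ^ DIM('a))"]
  show "integrable lborel (\<lambda>x. f (t + c *\<^sub>R x))"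
    using c by simp
  show "(LINT x|lborel. f x) = \<bar>c\<bar> ^ DIM('a) *\<^sub>R (LINT x|lborel. f (t + c *\<^sub>R x))"
    apply (subst lb)
    apply (subst integral_density)
    by (auto simp: integral_distr)
qed

text \<open>Preferred to a power of \<open>1 + norm x\<close> because it factors over the
  coordinates: its integrability is a one-variable fact and takes no polar coordinates.\<close>

definition decay_weight :: "'a::euclidean_space \<Rightarrow> real" where
  "decay_weight x = (\<Prod>b\<in>Basis. inverse (1 + (x \<bullet> b)\<^sup>2))"

lemma integrable_inverse_1_plus_square_lborel: "integrable lborel (\<lambda>x::real. inverse (1 + x\<^sup>2))"
  using integrable_inverse_1_plus_square by (simp add: set_integrable_def)

lemma integrable_decay_weight: "integrable lborel decay_weight"
  unfolding decay_weight_def[abs_def]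
  by (rule integrable_lborel_prod[of "\<lambda>_ t. inverse (1 + t\<^sup>2)"])
     (rule integrable_inverse_1_plus_square_lborel)

lemma decay_weight_pos: "decay_weight x > 0"
  unfolding decay_weight_def by (intro prod_pos) (auto simp: add_pos_nonneg)

lemma decay_weight_nonneg: "decay_weight x \<ge> 0"
  using decay_weight_pos[of x] by simp

text \<open>The axis of the largest coordinate does it, as it carries the largest factor of the
  reciprocal weight. Hence estimates along single axes suffice to bound a function by the
  weight.\<close>

lemma decay_weight_ge:
  fixes x :: "'a::euclidean_space"
  obtains b where "b \<in> Basis" "inverse (decay_weight x) \<le> (1 + (x \<bullet> b)\<^sup>2) ^ DIM('a)"
proof -
  have "finite ((\<lambda>b. 1 + (x \<bullet> b)\<^sup>2) ` Basis)" "((\<lambda>b. 1 + (x \<bullet> b)\<^sup>2) ` Basis) \<noteq> {}" by auto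
  from Max_in[OF this] have "\<exists>b\<in>Basis. Max ((\<lambda>b. 1 + (x \<bullet> b)\<^sup>2) ` Basis) = 1 + (x \<bullet> b)\<^sup>2"
    by (simp only: image_iff)
  then obtain b where b: "b \<in> Basis"
    "Max ((\<lambda>b. 1 + (x \<bullet> b)\<^sup>2) ` Basis) = 1 + (x \<bullet> b)\<^sup>2" ..
  have le: "1 + (x \<bullet> c)\<^sup>2 \<le> 1 + (x \<bullet> b)\<^sup>2" if "c \<in> Basis" for c
    unfolding b(2)[symmetric] using that by (intro Max_ge) auto
  have "inverse (decay_weight x) = (\<Prod>c\<in>Basis. 1 + (x \<bullet> c)\<^sup>2)"
    by (simp add: decay_weight_def prod_inversef[symmetric] o_def)
  also have "\<dots> \<le> (\<Prod>c\<in>(Basis::'a set). 1 + (x \<bullet> b)\<^sup>2)"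
    by (intro prod_mono) (use le in auto)
  finally show ?thesis using that[OF b(1)] by simp
qed

lemma norm_le_decay_weight:
  fixes f :: "'a::euclidean_space \<Rightarrow> 'b::real_normed_vector"
  assumes "\<And>b x. b \<in> Basis \<Longrightarrow> (1 + (x \<bullet> b)\<^sup>2) ^ DIM('a) * norm (f x) \<le> C"
  shows "norm (f x) \<le> C * decay_weight x"
proof -
  obtain b where b: "b \<in> Basis" "inverse (decay_weight x) \<le> (1 + (x \<bullet> b)\<^sup>2) ^ DIM('a)"
    using decay_weight_ge .
  then have "inverse (decay_weight x) * norm (f x) \<le> (1 + (x \<bullet> b)\<^sup>2) ^ DIM('a) * norm (f x)"
    by (intro mult_right_mono) auto
  also have "\<dots> \<le> C" using assms b by auto
  finally show ?thesis using decay_weight_pos[of x] by (simp add: field_simps)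
qed

section \<open>Fourier transforms and directional derivatives\<close>

lemma norm_exp_minus_ii_times [simp]: "norm (exp (- (\<i> * complex_of_real t))) = 1"
  by (simp add: norm_exp_eq_Re)

lemma integrable_fourier_integrand:
  assumes "integrable lborel f"
  shows "integrable lborel (\<lambda>x. f x * exp (- (\<i> * complex_of_real (x \<bullet> \<xi>))))"
  using assms by (rule Bochner_Integration.integrable_bound) (use assms in \<open>auto simp: norm_mult\<close>)

lemma norm_fourier_le:
  assumes "integrable lborel f"
  shows "norm (fourier f \<xi>) \<le> (LINT x|lborel. norm (f x))"
  unfolding fourier_def
  by (rule order_trans[OF integral_norm_bound]) (simp add: norm_mult)

lemma inv_fourier_eq:
  fixes g :: "'a::euclidean_space \<Rightarrow> complex"
  shows "inv_fourier g x = complex_of_real (1 / (2 * pi) ^ DIM('a)) * fourier g (- x)"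
  by (simp add: inv_fourier_def fourier_def inner_commute)

lemma continuous_on_fourier:
  assumes f: "integrable lborel f"
  shows "continuous_on UNIV (fourier f)"
  unfolding continuous_on_sequentially o_def
proof (intro allI ballI impI, elim conjE)
  fix u :: "nat \<Rightarrow> 'a" and a assume u: "u \<longlonglongrightarrow> a"
  have [measurable]: "f \<in> borel_measurable borel"
    using borel_measurable_integrable[OF f] by simp
  show "(\<lambda>n. fourier f (u n)) \<longlonglongrightarrow> fourier f a"
    unfolding fourier_def
    by (rule integral_dominated_convergence[where w="\<lambda>x. norm (f x)"])
       (use f u in \<open>auto simp: norm_mult intro!: tendsto_intros\<close>)
qed

lemma continuous_on_inv_fourier:
  assumes "integrable lborel g"
  shows "continuous_on UNIV (inv_fourier g)"
  unfolding inv_fourier_eq[abs_def]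
  by (intro continuous_intros continuous_on_compose2[OF continuous_on_fourier[OF assms]]) auto

text \<open>Translation invariance gives \<open>\<integral>\<phi>(x + b) - \<phi>(x) dx = 0\<close>; write the difference as an integral of the
  derivative over \<open>[0, 1]\<close> and exchange the integrals.\<close>

lemma integral_directional_derivative_eq_0:
  fixes \<phi> \<phi>' :: "'a::euclidean_space \<Rightarrow> complex"
  assumes int: "integrable lborel \<phi>" and int': "integrable lborel \<phi>'"
    and cont: "continuous_on UNIV \<phi>'"
    and der: "\<And>x. ((\<lambda>t. \<phi> (x + t *\<^sub>R b)) has_vector_derivative \<phi>' x) (at 0)"
  shows "(LINT x|lborel. \<phi>' x) = 0"
proof -
  have [measurable]: "\<phi> \<in> borel_measurable borel" "\<phi>' \<in> borel_measurable borel"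
    using borel_measurable_integrable[OF int] borel_measurable_integrable[OF int'] by auto
  \<comment> \<open>Moving the base point along the line turns the derivative at 0 into the
    derivative at every t.\<close>
  have der': "((\<lambda>t. \<phi> (x + t *\<^sub>R b)) has_vector_derivative \<phi>' (x + t *\<^sub>R b)) (at t)" for x t
  proof -
    have "((\<lambda>s. \<phi> ((x + t *\<^sub>R b) + s *\<^sub>R b)) has_vector_derivative \<phi>' (x + t *\<^sub>R b)) (at (t - t))"
      using der by simp
    then have "((\<lambda>s. \<phi> ((x + t *\<^sub>R b) + s *\<^sub>R b)) \<circ> (\<lambda>s. s - t) has_vector_derivative
        1 *\<^sub>R \<phi>' (x + t *\<^sub>R b)) (at t)"
      by (intro vector_diff_chain_at) (auto intro!: derivative_eq_intros simp: has_vector_derivative_def)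
    then show ?thesis by (simp add: o_def algebra_simps)
  qed
  have ftc: "(LINT t|lborel. indicator {0..1} t *\<^sub>R \<phi>' (x + t *\<^sub>R b)) = \<phi> (x + b) - \<phi> x" for x
  proof -
    have "continuous_on {0..1} (\<lambda>t. \<phi>' (x + t *\<^sub>R b))"
      by (intro continuous_on_compose2[OF cont] continuous_intros) auto
    from integral_FTC_Icc[OF zero_le_one has_vector_derivative_at_within[OF der'] this]
    show ?thesis by simp
  qed
  have trans: "integrable lborel (\<lambda>x. f (x + a))" "(LINT x|lborel. f (x + a)) = (LINT x|lborel. f x)"
    if "integrable lborel f" for f :: "'a \<Rightarrow> 'c::{banach,second_countable_topology}" and a
    using integrable_lborel_affine[OF _ that, of 1 a] integral_lborel_affine[OF _ that, of 1 a]
    by (simp_all add: add.commute)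
  \<comment> \<open>By translation invariance the inner L^1 norm does not depend on t, so the
    cut-off to [0, 1] yields joint integrability.\<close>
  have joint: "integrable (lborel \<Otimes>\<^sub>M lborel) (\<lambda>(t, x). indicator {0..1::real} t *\<^sub>R \<phi>' (x + t *\<^sub>R b))"
  proof (rule lborel_pair.Fubini_integrable)
    show "integrable lborel (\<lambda>t. LINT x|lborel. norm (case (t, x) of (t, x) \<Rightarrow> indicator {0..1::real} t *\<^sub>R \<phi>' (x + t *\<^sub>R b)))"
      using trans[OF integrable_norm[OF int']] by simp
  qed (use trans[OF int'] in auto)
  have "(LINT x|lborel. \<phi>' x) = (LINT t|lborel. indicator {0..1::real} t *\<^sub>R (LINT x|lborel. \<phi>' x))"
    by simp
  also have "\<dots> = (LINT t|lborel. LINT x|lborel. indicator {0..1::real} t *\<^sub>R \<phi>' (x + t *\<^sub>R b))"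
    using trans(2)[OF int'] by simp
  also have "\<dots> = (LINT x|lborel. LINT t|lborel. indicator {0..1::real} t *\<^sub>R \<phi>' (x + t *\<^sub>R b))"
    using lborel_pair.Fubini_integral[OF joint] by simp
  also have "\<dots> = (LINT x|lborel. \<phi> (x + b) - \<phi> x)"
    unfolding ftc ..
  also have "\<dots> = 0"
    using trans[OF int] int by simp
  finally show ?thesis .
qed

text \<open>Integration by parts without boundary terms: the derivative of \<open>\<phi>\<close>
  times the character has integral 0, and the product rule splits it into the two sides of the
  equation.\<close>

lemma fourier_directional_derivative:
  fixes \<phi> \<phi>' :: "'a::euclidean_space \<Rightarrow> complex"
  assumes int: "integrable lborel \<phi>" and int': "integrable lborel \<phi>'"
    and cont: "continuous_on UNIV \<phi>" and cont': "continuous_on UNIV \<phi>'"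
    and der: "\<And>x. ((\<lambda>t. \<phi> (x + t *\<^sub>R b)) has_vector_derivative \<phi>' x) (at 0)"
  shows "fourier \<phi>' \<xi> = \<i> * complex_of_real (b \<bullet> \<xi>) * fourier \<phi> \<xi>"
proof -
  define E where "E x = exp (- (\<i> * complex_of_real (x \<bullet> \<xi>)))" for x
  define \<psi> where "\<psi> x = \<phi>' x * E x - \<i> * complex_of_real (b \<bullet> \<xi>) * (\<phi> x * E x)" for x
  have int1: "integrable lborel (\<lambda>x. \<phi> x * E x)" "integrable lborel (\<lambda>x. \<phi>' x * E x)"
    unfolding E_def using int int' by (auto intro: integrable_fourier_integrand)
  have "(LINT x|lborel. \<psi> x) = 0"
  proof (rule integral_directional_derivative_eq_0)
    show "integrable lborel (\<lambda>x. \<phi> x * E x)" by fact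
    show "integrable lborel \<psi>" unfolding \<psi>_def using int1 by auto
    show "continuous_on UNIV \<psi>" unfolding \<psi>_def E_def
      by (intro continuous_intros cont cont')
    fix x
    have "((\<lambda>t. E (x + t *\<^sub>R b)) has_vector_derivative (E x * (- (\<i> * complex_of_real (b \<bullet> \<xi>))))) (at 0)"
      unfolding E_def
      by (auto intro!: derivative_eq_intros has_vector_derivative_real_field simp: inner_add_left)
    from has_vector_derivative_mult[OF der[of x] this]
    show "((\<lambda>t. \<phi> (x + t *\<^sub>R b) * E (x + t *\<^sub>R b)) has_vector_derivative \<psi> x) (at 0)"
      by (simp add: \<psi>_def algebra_simps)
  qed
  moreover have "(LINT x|lborel. \<psi> x) = fourier \<phi>' \<xi> - \<i> * complex_of_real (b \<bullet> \<xi>) * fourier \<phi> \<xi>"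
    unfolding \<psi>_def using int1 by (simp add: fourier_def E_def)
  ultimately show ?thesis by simp
qed

section \<open>Smoothness along one axis and decay of the Fourier transform\<close>

text \<open>Only pure derivatives along one direction are recorded, since decay is tested along one
  axis at a time and mixed derivatives never arise. \<open>P\<close> is a parameter because
  smoothness of the symbols is built up in \<open>compact_cont\<close> and then weakened to
  \<open>cont_integrable\<close>.\<close>

primrec dir_smooth ::
    "(('a::euclidean_space \<Rightarrow> complex) \<Rightarrow> bool) \<Rightarrow> 'a \<Rightarrow> nat \<Rightarrow> ('a \<Rightarrow> complex) \<Rightarrow> bool" where
  "dir_smooth P b 0 f \<longleftrightarrow> P f"
| "dir_smooth P b (Suc k) f \<longleftrightarrow> P f \<and>
     (\<exists>f'. (\<forall>x. ((\<lambda>t. f (x + t *\<^sub>R b)) has_vector_derivative f' x) (at 0)) \<and> dir_smooth P b k f')"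

lemma dir_smooth_base: "dir_smooth P b k f \<Longrightarrow> P f"
  by (cases k) auto

lemma dir_smooth_Suc_lower: "dir_smooth P b (Suc k) f \<Longrightarrow> dir_smooth P b k f"
proof (induction k arbitrary: f)
  case (Suc k)
  from Suc.prems obtain f' where P: "P f" and
    f': "\<forall>x. ((\<lambda>t. f (x + t *\<^sub>R b)) has_vector_derivative f' x) (at 0)" "dir_smooth P b (Suc k) f'"
    unfolding dir_smooth.simps(2)[of _ _ "Suc k"] by blast
  from Suc.IH[OF f'(2)] f'(1) P show ?case
    by (subst dir_smooth.simps(2)) blast
qed auto

lemma dir_smooth_mono:
  assumes "dir_smooth P b k f" "\<And>f. P f \<Longrightarrow> Q f"
  shows "dir_smooth Q b k f"
  using assms(1) by (induction k arbitrary: f) (auto intro: assms(2))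

definition cont_integrable :: "('a::euclidean_space \<Rightarrow> complex) \<Rightarrow> bool" where
  "cont_integrable f \<longleftrightarrow> continuous_on UNIV f \<and> integrable lborel f"

text \<open>Each derivative along \<open>b\<close> multiplies the transform by i times the
  coordinate \<open>b \<bullet> \<xi>\<close>; the transform of the last derivative is bounded by
  its L^1 norm.\<close>

lemma fourier_decay_direction:
  assumes "dir_smooth cont_integrable b k f"
  shows "\<exists>C. \<forall>\<xi>. \<bar>b \<bullet> \<xi>\<bar> ^ k * norm (fourier f \<xi>) \<le> C"
  using assms
proof (induction k arbitrary: f)
  case 0
  then show ?case using norm_fourier_le[of f] by (auto simp: cont_integrable_def)
next
  case (Suc k)
  from Suc.prems obtain f' where f: "cont_integrable f" and
    der: "\<And>x. ((\<lambda>t. f (x + t *\<^sub>R b)) has_vector_derivative f' x) (at 0)" and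
    f': "dir_smooth cont_integrable b k f'" by auto
  have "fourier f' \<xi> = \<i> * complex_of_real (b \<bullet> \<xi>) * fourier f \<xi>" for \<xi>
    using f dir_smooth_base[OF f'] der
    by (intro fourier_directional_derivative) (auto simp: cont_integrable_def)
  with Suc.IH[OF f'] show ?case by (simp add: norm_mult mult_ac)
qed

text \<open>The reciprocal weight is at most the d-th power of 1 plus the square of a single
  coordinate, with d = \<open>DIM('a)\<close>; this is why 2 d derivatives are taken.\<close>

lemma fourier_decay_weight:
  fixes f :: "'a::euclidean_space \<Rightarrow> complex"
  assumes f: "\<And>b. b \<in> Basis \<Longrightarrow> dir_smooth cont_integrable b (2 * DIM('a)) f"
  obtains C where "C \<ge> 0" "\<And>\<xi>. norm (fourier f \<xi>) \<le> C * decay_weight \<xi>"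
proof -
  obtain b0 :: 'a where "b0 \<in> Basis" using nonempty_Basis by blast
  then have int: "integrable lborel f"
    using dir_smooth_base[OF f] by (auto simp: cont_integrable_def)
  define A where "A = (LINT x|lborel. norm (f x))"
  have "\<forall>b\<in>Basis. \<exists>C. \<forall>\<xi>. \<bar>b \<bullet> \<xi>\<bar> ^ (2 * DIM('a)) * norm (fourier f \<xi>) \<le> C"
    using fourier_decay_direction[OF f] by blast
  then obtain C where C: "\<And>b \<xi>. b \<in> Basis \<Longrightarrow> \<bar>b \<bullet> \<xi>\<bar> ^ (2 * DIM('a)) * norm (fourier f \<xi>) \<le> C b"
    by metis
  have C0: "C b \<ge> 0" if "b \<in> Basis" for b
    by (rule order_trans[OF _ C[OF that, of 0]]) auto
  \<comment> \<open>\<open>A\<close> handles a coordinate of size at most 1 and the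
    \<open>C b\<close> a large one. All \<open>C b\<close> are summed since the relevant axis varies
    with the point; the power of 2 comes from 1 + t^2 \<le> 2 max(1, t^2).\<close>
  define B where "B = 2 ^ DIM('a) * (A + (\<Sum>b\<in>Basis. C b))"
  show ?thesis
  proof
    show "B \<ge> 0" unfolding B_def A_def using C0 by (auto intro!: mult_nonneg_nonneg add_nonneg_nonneg sum_nonneg)
    fix \<xi> :: 'a
    show "norm (fourier f \<xi>) \<le> B * decay_weight \<xi>"
    proof (rule norm_le_decay_weight)
      fix b \<xi> :: 'a assume b: "b \<in> Basis"
      have "(1 + (\<xi> \<bullet> b)\<^sup>2) ^ DIM('a) \<le> (2 * max 1 ((\<xi> \<bullet> b)\<^sup>2)) ^ DIM('a)"
        by (intro power_mono) auto
      also have "\<dots> \<le> 2 ^ DIM('a) * (1 + \<bar>b \<bullet> \<xi>\<bar> ^ (2 * DIM('a)))"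
        by (auto simp: power_mult_distrib max_def inner_commute power_mult)
      finally have "(1 + (\<xi> \<bullet> b)\<^sup>2) ^ DIM('a) * norm (fourier f \<xi>) \<le>
          2 ^ DIM('a) * (1 + \<bar>b \<bullet> \<xi>\<bar> ^ (2 * DIM('a))) * norm (fourier f \<xi>)"
        by (rule mult_right_mono) auto
      also have "\<dots> = 2 ^ DIM('a) * (norm (fourier f \<xi>) + \<bar>b \<bullet> \<xi>\<bar> ^ (2 * DIM('a)) * norm (fourier f \<xi>))"
        by (simp add: algebra_simps)
      also have "\<dots> \<le> 2 ^ DIM('a) * (A + (\<Sum>b\<in>Basis. C b))"
        using norm_fourier_le[OF int, of \<xi>] C[OF b, of \<xi>] member_le_sum[OF b, of C] C0
        by (intro mult_left_mono add_mono) (auto simp: A_def)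
      finally show "(1 + (\<xi> \<bullet> b)\<^sup>2) ^ DIM('a) * norm (fourier f \<xi>) \<le> B" by (simp add: B_def)
    qed
  qed
qed

section \<open>Rapidly decreasing functions\<close>

text \<open>The size condition on Schwartz functions without the smoothness. A bounded measurable
  symbol times the transform of a Schwartz function stays in this class.\<close>

definition rapid :: "('a::euclidean_space \<Rightarrow> complex) \<Rightarrow> bool" where
  "rapid f \<longleftrightarrow> f \<in> borel_measurable borel \<and>
     (\<forall>k::nat. \<exists>C::real. \<forall>x. (1 + norm x) ^ k * norm (f x) \<le> C)"

lemma rapid_integrable:
  fixes f :: "'a::euclidean_space \<Rightarrow> complex"
  assumes f: "rapid f"
  shows "integrable lborel f"
proof -
  obtain C where C: "\<And>x. (1 + norm x) ^ (2 * DIM('a)) * norm (f x) \<le> C"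
    using f unfolding rapid_def by blast
  have "norm (f x) \<le> C * decay_weight x" for x
  proof (rule norm_le_decay_weight)
    fix b x :: 'a assume "b \<in> Basis"
    then have "(x \<bullet> b)\<^sup>2 \<le> (norm x)\<^sup>2"
      using power_mono[OF Basis_le_norm[of b x], of 2] by (simp only: power2_abs abs_ge_zero)
    moreover have "(1 + norm x)\<^sup>2 = 1 + (norm x)\<^sup>2 + 2 * norm x" by (simp add: power2_sum)
    ultimately have "1 + (x \<bullet> b)\<^sup>2 \<le> (1 + norm x)\<^sup>2"
      using norm_ge_zero[of x] by linarith
    from power_mono[OF this, of "DIM('a)"]
    have "(1 + (x \<bullet> b)\<^sup>2) ^ DIM('a) \<le> (1 + norm x) ^ (2 * DIM('a))"
      by (simp add: power_mult add_nonneg_nonneg)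
    then have "(1 + (x \<bullet> b)\<^sup>2) ^ DIM('a) * norm (f x) \<le> (1 + norm x) ^ (2 * DIM('a)) * norm (f x)"
      by (rule mult_right_mono) simp
    also have "\<dots> \<le> C" by (rule C)
    finally show "(1 + (x \<bullet> b)\<^sup>2) ^ DIM('a) * norm (f x) \<le> C" .
  qed
  then have le: "norm (f x) \<le> norm (C * decay_weight x)" for x
    using abs_ge_self order_trans unfolding real_norm_def by blast
  show ?thesis
  proof (rule Bochner_Integration.integrable_bound)
    show "integrable lborel (\<lambda>x::'a. C * decay_weight x)"
      by (intro integrable_mult_right integrable_decay_weight)
    show "f \<in> borel_measurable lborel" using f by (simp add: rapid_def)
    show "AE x in lborel. norm (f x) \<le> norm (C * decay_weight x)" using le by (rule AE_I2)
  qed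
qed

lemma rapid_bounded:
  assumes "rapid f"
  obtains B where "\<And>x. norm (f x) \<le> B"
proof -
  have "\<exists>C. \<forall>x. (1 + norm x) ^ 0 * norm (f x) \<le> C"
    using assms unfolding rapid_def by blast
  then show ?thesis using that by auto
qed

lemma rapid_times_bounded:
  assumes f: "rapid f" and [measurable]: "m \<in> borel_measurable borel"
    and m: "\<And>x. norm (m x) \<le> B"
  shows "rapid (\<lambda>x. m x * f x)"
  unfolding rapid_def
proof (intro conjI allI)
  have [measurable]: "f \<in> borel_measurable borel" using f by (simp add: rapid_def)
  show "(\<lambda>x. m x * f x) \<in> borel_measurable borel" by measurable
  fix k
  obtain C where C: "\<And>x. (1 + norm x) ^ k * norm (f x) \<le> C"
    using f unfolding rapid_def by blast
  have "(1 + norm x) ^ k * norm (m x * f x) \<le> B * C" for x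
  proof -
    have "(1 + norm x) ^ k * norm (m x * f x) = norm (m x) * ((1 + norm x) ^ k * norm (f x))"
      by (simp add: norm_mult)
    also have "\<dots> \<le> B * C" using m C order_trans[OF norm_ge_zero m]
      by (intro mult_mono) auto
    finally show ?thesis .
  qed
  then show "\<exists>C. \<forall>x. (1 + norm x) ^ k * norm (m x * f x) \<le> C" by blast
qed

lemma rapid_times_linear:
  assumes f: "rapid f" and [measurable]: "m \<in> borel_measurable borel"
    and m: "\<And>x. norm (m x) \<le> B * (1 + norm x)"
  shows "rapid (\<lambda>x. m x * f x)"
  unfolding rapid_def
proof (intro conjI allI)
  have [measurable]: "f \<in> borel_measurable borel" using f by (simp add: rapid_def)
  show "(\<lambda>x. m x * f x) \<in> borel_measurable borel" by measurable
  have B: "B \<ge> 0" using order_trans[OF norm_ge_zero m, of 0] by simp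
  fix k
  \<comment> \<open>One power more than requested, to absorb the linear growth of
    \<open>m\<close>.\<close>
  obtain C where C: "\<And>x. (1 + norm x) ^ (Suc k) * norm (f x) \<le> C"
    using f unfolding rapid_def by blast
  have "(1 + norm x) ^ k * norm (m x * f x) \<le> B * C" for x
  proof -
    have "(1 + norm x) ^ k * norm (m x * f x) = norm (m x) * ((1 + norm x) ^ k * norm (f x))"
      by (simp add: norm_mult)
    also have "\<dots> \<le> B * (1 + norm x) * ((1 + norm x) ^ k * norm (f x))"
      using m by (intro mult_right_mono) auto
    also have "\<dots> = B * ((1 + norm x) ^ (Suc k) * norm (f x))" by simp
    also have "\<dots> \<le> B * C" using B C by (intro mult_left_mono) auto
    finally show ?thesis .
  qed
  then show "\<exists>C. \<forall>x. (1 + norm x) ^ k * norm (m x * f x) \<le> C" by blast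
qed

lemma rapid_times_inner:
  assumes "rapid f"
  shows "rapid (\<lambda>x. complex_of_real (c \<bullet> x) * f x)"
proof (rule rapid_times_linear[OF assms])
  fix x
  have "norm (complex_of_real (c \<bullet> x)) \<le> norm c * norm x" using Cauchy_Schwarz_ineq2 by simp
  also have "\<dots> \<le> norm c * (1 + norm x)" by (intro mult_left_mono) auto
  finally show "norm (complex_of_real (c \<bullet> x)) \<le> norm c * (1 + norm x)" .
qed auto

lemma rapid_times_ii_inner:
  "rapid f \<Longrightarrow> rapid (\<lambda>x. \<i> * complex_of_real (c \<bullet> x) * f x)"
  using rapid_times_bounded[OF rapid_times_inner, of f "\<lambda>_. \<i>" 1 c] by (simp add: mult_ac)

lemma norm_le_DIM_times_coordinate:
  fixes x :: "'a::euclidean_space"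
  obtains b where "b \<in> Basis" "norm x \<le> DIM('a) * \<bar>b \<bullet> x\<bar>"
proof (rule ccontr)
  assume "\<not> thesis"
  with that have *: "\<And>b. b \<in> Basis \<Longrightarrow> \<bar>x \<bullet> b\<bar> < norm x / DIM('a)"
    by (force simp: field_simps inner_commute not_le)
  have "norm x \<le> (\<Sum>b\<in>Basis. \<bar>x \<bullet> b\<bar>)" by (rule norm_le_l1)
  also have "\<dots> < (\<Sum>b\<in>(Basis::'a set). norm x / DIM('a))"
    using * by (intro sum_strict_mono) auto
  also have "\<dots> = norm x" by simp
  finally show False by simp
qed

text \<open>Differentiation along an axis controls powers of that coordinate only. Since some
  coordinate is at least the norm divided by the dimension, this controls all powers of the
  norm.\<close>

lemma rapidI_coordinates:
  fixes f :: "'a::euclidean_space \<Rightarrow> complex"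
  assumes meas: "f \<in> borel_measurable borel"
    and C: "\<And>b k. b \<in> Basis \<Longrightarrow> \<exists>C. \<forall>x. \<bar>b \<bullet> x\<bar> ^ k * norm (f x) \<le> C"
  shows "rapid f"
  unfolding rapid_def
proof (intro conjI meas allI)
  fix k
  have "\<forall>b\<in>(Basis::'a set). \<exists>C. \<forall>x. \<bar>b \<bullet> x\<bar> ^ k * norm (f x) \<le> C" using C by blast
  then obtain C1 where C1: "\<And>b x. b \<in> Basis \<Longrightarrow> \<bar>b \<bullet> x\<bar> ^ k * norm (f x) \<le> C1 b" by metis
  obtain b0 :: 'a where b0: "b0 \<in> Basis" using nonempty_Basis by blast
  obtain C0 where C0: "\<And>x. norm (f x) \<le> C0" using C[OF b0, of 0] by auto
  have C1_nonneg: "C1 b \<ge> 0" if "b \<in> Basis" for b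
    by (rule order_trans[OF _ C1[OF that, of 0]]) auto
  have "(1 + norm x) ^ k * norm (f x) \<le> 2 ^ k * (C0 + DIM('a) ^ k * (\<Sum>b\<in>Basis. C1 b))" for x
  proof -
    obtain b :: 'a where b: "b \<in> Basis" "norm x \<le> DIM('a) * \<bar>b \<bullet> x\<bar>"
      by (rule norm_le_DIM_times_coordinate)
    have "(1 + norm x) ^ k \<le> (2 * max 1 (norm x)) ^ k" by (intro power_mono) auto
    also have "\<dots> \<le> 2 ^ k * (1 + norm x ^ k)"
      by (auto simp: power_mult_distrib max_def)
    also have "\<dots> \<le> 2 ^ k * (1 + (DIM('a) * \<bar>b \<bullet> x\<bar>) ^ k)"
      using b by (intro mult_left_mono add_left_mono power_mono) auto
    finally have "(1 + norm x) ^ k * norm (f x) \<le> 2 ^ k * (1 + (DIM('a) * \<bar>b \<bullet> x\<bar>) ^ k) * norm (f x)"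
      by (rule mult_right_mono) auto
    also have "\<dots> = 2 ^ k * (norm (f x) + DIM('a) ^ k * (\<bar>b \<bullet> x\<bar> ^ k * norm (f x)))"
      by (simp add: algebra_simps power_mult_distrib)
    also have "\<dots> \<le> 2 ^ k * (C0 + DIM('a) ^ k * (\<Sum>b\<in>Basis. C1 b))"
    proof -
      have "\<bar>b \<bullet> x\<bar> ^ k * norm (f x) \<le> (\<Sum>b\<in>Basis. C1 b)"
        using C1[OF b(1), of x] member_le_sum[OF b(1), of C1] C1_nonneg by fastforce
      then show ?thesis using C0[of x]
        by (intro mult_left_mono add_mono) auto
    qed
    finally show ?thesis .
  qed
  then show "\<exists>C. \<forall>x. (1 + norm x) ^ k * norm (f x) \<le> C" by blast
qed

lemma schwartz_iter_partial:
  assumes "schwartz f" "bs \<in> lists Basis"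
  shows "continuous_on UNIV (iter_partial bs f)" "rapid (iter_partial bs f)"
proof -
  show *: "continuous_on UNIV (iter_partial bs f)"
    using assms by (auto simp: schwartz_def intro: differentiable_imp_continuous_on)
  then show "rapid (iter_partial bs f)"
    using assms by (auto simp: schwartz_def rapid_def borel_measurable_continuous_onI)
qed

lemma schwartz_rapid: "schwartz f \<Longrightarrow> rapid f"
  and schwartz_continuous: "schwartz f \<Longrightarrow> continuous_on UNIV f"
  using schwartz_iter_partial[of f "[]"] by auto

text \<open>The derivatives already taken are counted by \<open>n\<close>, so that one further
  derivative leads to the same statement with \<open>Suc n\<close> and the induction on
  \<open>k\<close> closes.\<close>

lemma schwartz_dir_smooth:
  assumes f: "schwartz f" and b: "b \<in> Basis"
  shows "dir_smooth cont_integrable b k (iter_partial (replicate n b) f)"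
proof (induction k arbitrary: n)
  case 0
  show ?case using schwartz_iter_partial[OF f, of "replicate n b"] b
    by (auto simp: cont_integrable_def rapid_integrable in_lists_conv_set)
next
  case (Suc k)
  have mem: "replicate n b \<in> lists Basis" using b by (auto simp: in_lists_conv_set)
  let ?g = "iter_partial (replicate n b) f"
  have "((\<lambda>t. ?g (x + t *\<^sub>R b)) has_vector_derivative partial_deriv b ?g x) (at 0)" for x
  proof -
    have "?g differentiable at (x + 0 *\<^sub>R b)"
      using f mem by (auto simp: schwartz_def differentiable_on_def)
    then have "(?g has_derivative frechet_derivative ?g (at x)) (at (x + 0 *\<^sub>R b))"
      by (simp add: frechet_derivative_works)
    then have "((\<lambda>t. ?g (x + t *\<^sub>R b)) has_derivative
        (\<lambda>t. frechet_derivative ?g (at x) (t *\<^sub>R b))) (at 0)"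
      by (rule has_derivative_compose[rotated]) (auto intro!: derivative_eq_intros)
    moreover have "linear (frechet_derivative ?g (at x))"
      using \<open>?g differentiable at (x + 0 *\<^sub>R b)\<close> by (simp add: linear_frechet_derivative)
    ultimately show ?thesis
      by (simp add: has_vector_derivative_def partial_deriv_def linear_cmul)
  qed
  moreover have "dir_smooth cont_integrable b k (partial_deriv b ?g)"
    using Suc.IH[of "Suc n"] by simp
  moreover have "cont_integrable ?g"
    using schwartz_iter_partial[OF f mem] by (auto simp: cont_integrable_def rapid_integrable)
  ultimately show ?case by (auto simp del: replicate.simps)
qed

lemma rapid_fourier:
  assumes f: "schwartz f"
  shows "rapid (fourier f)"
proof (rule rapidI_coordinates)
  show "fourier f \<in> borel_measurable borel"
    using continuous_on_fourier[OF rapid_integrable[OF schwartz_rapid[OF f]]]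
    by (rule borel_measurable_continuous_onI)
  fix b :: 'a and k assume "b \<in> Basis"
  with fourier_decay_direction[OF schwartz_dir_smooth[OF f this, of k 0]]
  show "\<exists>C. \<forall>x. \<bar>b \<bullet> x\<bar> ^ k * norm (fourier f x) \<le> C" by simp
qed

section \<open>Differentiability of inverse Fourier transforms\<close>

lemma integrable_inv_fourier_integrand:
  assumes "integrable lborel g"
  shows "integrable lborel (\<lambda>\<xi>. g \<xi> * exp (\<i> * complex_of_real (x \<bullet> \<xi>)))"
  using assms by (rule Bochner_Integration.integrable_bound) (use assms in \<open>auto simp: norm_mult\<close>)

text \<open>Differentiation under the integral by Taylor expansion: exp(i a) differs from 1 + i a by
  at most a^2, so the error is quadratic in \<open>y - x\<close>, with the finite second moment of
  \<open>g\<close> as its constant.\<close>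

lemma inv_fourier_has_derivative:
  fixes g :: "'a::euclidean_space \<Rightarrow> complex"
  assumes g: "rapid g"
  shows "(inv_fourier g has_derivative (\<lambda>h. inv_fourier (\<lambda>\<xi>. \<i> * complex_of_real (h \<bullet> \<xi>) * g \<xi>) x)) (at x)"
proof -
  define E where "E x \<xi> = exp (\<i> * complex_of_real (x \<bullet> \<xi>))" for x \<xi> :: 'a
  define c where "c = (1 / (2 * pi) ^ DIM('a))"
  have c: "c > 0" unfolding c_def by simp
  have inv: "inv_fourier h x = complex_of_real c * (LINT \<xi>|lborel. h \<xi> * E x \<xi>)" for h x
    by (simp add: inv_fourier_def E_def c_def)
  have int: "integrable lborel (\<lambda>\<xi>. h \<xi> * E x \<xi>)" if "rapid h" for h x
    unfolding E_def by (intro integrable_inv_fourier_integrand rapid_integrable that)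
  have [measurable]: "g \<in> borel_measurable borel" using g by (simp add: rapid_def)
  have "rapid (\<lambda>\<xi>. complex_of_real ((norm \<xi>)) * (complex_of_real (norm \<xi>) * g \<xi>))"
    by (intro rapid_times_linear[where B=1] g) auto
  then have int2: "integrable lborel (\<lambda>\<xi>. (norm \<xi>)\<^sup>2 * norm (g \<xi>))"
    by (drule_tac integrable_norm[OF rapid_integrable]) (simp add: norm_mult power2_eq_square mult_ac)
  define B where "B = c * (LINT \<xi>|lborel. (norm \<xi>)\<^sup>2 * norm (g \<xi>))"
  let ?D = "\<lambda>h. inv_fourier (\<lambda>\<xi>. \<i> * complex_of_real (h \<bullet> \<xi>) * g \<xi>) x"
  have int1: "integrable lborel (\<lambda>\<xi>. \<i> * complex_of_real (h \<bullet> \<xi>) * g \<xi> * E x \<xi>)" for h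
    by (intro int rapid_times_ii_inner g)
  have lin: "linear ?D"
  proof (rule linearI)
    fix h k
    have eq: "\<i> * complex_of_real ((h + k) \<bullet> \<xi>) * g \<xi> * E x \<xi> =
        \<i> * complex_of_real (h \<bullet> \<xi>) * g \<xi> * E x \<xi> + \<i> * complex_of_real (k \<bullet> \<xi>) * g \<xi> * E x \<xi>" for \<xi>
      by (simp only: inner_add_left of_real_add ring_distribs)
    show "?D (h + k) = ?D h + ?D k"
      unfolding inv eq using Bochner_Integration.integral_add[OF int1[of h] int1[of k]]
      by (simp only: ring_distribs)
  next
    fix r h
    have eq: "\<i> * complex_of_real ((r *\<^sub>R h) \<bullet> \<xi>) * g \<xi> * E x \<xi> =
        complex_of_real r * (\<i> * complex_of_real (h \<bullet> \<xi>) * g \<xi> * E x \<xi>)" for \<xi>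
      by (simp only: inner_scaleR_left of_real_mult mult_ac)
    show "?D (r *\<^sub>R h) = r *\<^sub>R ?D h"
      unfolding inv eq integral_mult_right_zero scaleR_conv_of_real by (simp only: mult_ac)
  qed
  have bound: "norm (inv_fourier g y - inv_fourier g x - ?D (y - x)) \<le> B * (norm (y - x))\<^sup>2" for y
  proof -
    have pw: "norm (g \<xi> * E y \<xi> - g \<xi> * E x \<xi> - \<i> * complex_of_real ((y - x) \<bullet> \<xi>) * g \<xi> * E x \<xi>) \<le>
         (norm (y - x))\<^sup>2 * ((norm \<xi>)\<^sup>2 * norm (g \<xi>))" for \<xi>
    proof -
      let ?a = "(y - x) \<bullet> \<xi>"
      have "E y \<xi> = E x \<xi> * exp (\<i> * complex_of_real ?a)"
        unfolding E_def exp_add[symmetric] by (simp only: inner_diff_left of_real_diff right_diff_distrib) simp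
      then have "g \<xi> * E y \<xi> - g \<xi> * E x \<xi> - \<i> * complex_of_real ?a * g \<xi> * E x \<xi> =
          (g \<xi> * E x \<xi>) * (exp (\<i> * complex_of_real ?a) - (1 + \<i> * complex_of_real ?a))"
        by (simp add: algebra_simps)
      also have "norm \<dots> = norm (g \<xi>) * norm (exp (\<i> * complex_of_real ?a) - (1 + \<i> * complex_of_real ?a))"
        by (simp add: norm_mult E_def)
      also have "\<dots> \<le> norm (g \<xi>) * (norm (y - x) * norm \<xi>)\<^sup>2"
      proof (intro mult_left_mono)
        have "norm (exp (\<i> * complex_of_real ?a) - (1 + \<i> * complex_of_real ?a)) \<le> \<bar>?a\<bar>\<^sup>2 / 2"
          using iexp_approx1[of ?a 1] by (simp add: numeral_2_eq_2)
        also have "\<dots> \<le> \<bar>?a\<bar>\<^sup>2" by simp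
        also have "\<dots> \<le> (norm (y - x) * norm \<xi>)\<^sup>2"
          by (intro power_mono Cauchy_Schwarz_ineq2) auto
        finally show "norm (exp (\<i> * complex_of_real ?a) - (1 + \<i> * complex_of_real ?a)) \<le> (norm (y - x) * norm \<xi>)\<^sup>2" .
      qed auto
      also have "\<dots> = (norm (y - x))\<^sup>2 * ((norm \<xi>)\<^sup>2 * norm (g \<xi>))"
        by (simp add: power_mult_distrib)
      finally show ?thesis .
    qed
    have eq: "inv_fourier g y - inv_fourier g x - ?D (y - x) =
        complex_of_real c * (LINT \<xi>|lborel. g \<xi> * E y \<xi> - g \<xi> * E x \<xi> - \<i> * complex_of_real ((y - x) \<bullet> \<xi>) * g \<xi> * E x \<xi>)"
      using int[OF g] int1 by (simp add: inv right_diff_distrib)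
    have "norm (inv_fourier g y - inv_fourier g x - ?D (y - x)) = c * norm (LINT \<xi>|lborel. g \<xi> * E y \<xi> - g \<xi> * E x \<xi> - \<i> * complex_of_real ((y - x) \<bullet> \<xi>) * g \<xi> * E x \<xi>)"
      unfolding eq norm_mult using c by simp
    also have "\<dots> \<le> c * (LINT \<xi>|lborel. (norm (y - x))\<^sup>2 * ((norm \<xi>)\<^sup>2 * norm (g \<xi>)))"
    proof (rule mult_left_mono, rule Bochner_Integration.integral_norm_bound_integral)
      show "integrable lborel (\<lambda>\<xi>. g \<xi> * E y \<xi> - g \<xi> * E x \<xi> - \<i> * complex_of_real ((y - x) \<bullet> \<xi>) * g \<xi> * E x \<xi>)"
        using int[OF g] int1 by (intro Bochner_Integration.integrable_diff)
      show "integrable lborel (\<lambda>\<xi>. (norm (y - x))\<^sup>2 * ((norm \<xi>)\<^sup>2 * norm (g \<xi>)))"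
        using int2 by simp
      show "norm (g \<xi> * E y \<xi> - g \<xi> * E x \<xi> - \<i> * complex_of_real ((y - x) \<bullet> \<xi>) * g \<xi> * E x \<xi>) \<le>
         (norm (y - x))\<^sup>2 * ((norm \<xi>)\<^sup>2 * norm (g \<xi>))" for \<xi>
        by (rule pw)
      show "0 \<le> c" using c by simp
    qed
    also have "\<dots> = B * (norm (y - x))\<^sup>2"
      unfolding B_def by simp
    finally show ?thesis .
  qed
  show ?thesis
  proof (rule has_derivativeI_sandwich[where e=1])
    show "bounded_linear ?D" using lin unfolding linear_conv_bounded_linear .
    show "((\<lambda>y. B * norm (y - x)) \<longlongrightarrow> 0) (at x)"
      by (intro tendsto_mult_right_zero tendsto_norm_zero LIM_zero tendsto_ident_at)
    fix y assume "y \<noteq> x"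
    then have pos: "norm (y - x) > 0" by simp
    then show "norm (inv_fourier g y - inv_fourier g x - ?D (y - x)) / norm (y - x) \<le> B * norm (y - x)"
      unfolding pos_divide_le_eq[OF pos] using bound[of y] by (metis power2_eq_square mult.assoc)
  qed simp
qed

section \<open>Gaussians\<close>

lemma rapid_add:
  assumes "rapid f" "rapid g"
  shows "rapid (\<lambda>x. f x + g x)"
  unfolding rapid_def
proof (intro conjI allI)
  show "(\<lambda>x. f x + g x) \<in> borel_measurable borel"
    using assms unfolding rapid_def by (intro borel_measurable_add) auto
  fix k
  obtain C D where C: "\<And>x. (1 + norm x) ^ k * norm (f x) \<le> C"
    and D: "\<And>x. (1 + norm x) ^ k * norm (g x) \<le> D"
    using assms unfolding rapid_def by meson
  have "(1 + norm x) ^ k * norm (f x + g x) \<le> C + D" for x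
  proof -
    have "(1 + norm x) ^ k * norm (f x + g x) \<le> (1 + norm x) ^ k * (norm (f x) + norm (g x))"
      by (intro mult_left_mono norm_triangle_ineq) auto
    also have "\<dots> \<le> C + D"
      using C[of x] D[of x] by (simp add: distrib_left)
    finally show ?thesis .
  qed
  then show "\<exists>C. \<forall>x. (1 + norm x) ^ k * norm (f x + g x) \<le> C" by blast
qed

text \<open>With this normalisation the function is its own Fourier transform up to the factor
  \<open>sqrt (2 * pi) ^ DIM('a)\<close>.\<close>

definition gauss :: "'a::euclidean_space \<Rightarrow> real" where
  "gauss x = exp (- ((norm x)\<^sup>2 / 2))"

lemma gauss_pos: "gauss x > 0"
  and gauss_le_1: "gauss x \<le> 1"
  by (simp_all add: gauss_def)

lemma power_le_fact_exp:
  assumes "x \<ge> (0::real)"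
  shows "x ^ k \<le> fact k * exp x"
proof -
  have "(\<Sum>n\<in>{k}. x ^ n /\<^sub>R fact n) \<le> (\<Sum>n. x ^ n /\<^sub>R fact n)"
    using assms by (intro sum_le_suminf summable_exp_generic) auto
  then show ?thesis by (simp add: exp_def[symmetric] exp_def field_simps)
qed

lemma rapid_gauss_scaled:
  assumes "\<epsilon> > 0"
  shows "rapid (\<lambda>x::'a::euclidean_space. complex_of_real (gauss (\<epsilon> *\<^sub>R x)))"
  unfolding rapid_def
proof (intro conjI allI)
  show "(\<lambda>x::'a. complex_of_real (gauss (\<epsilon> *\<^sub>R x))) \<in> borel_measurable borel"
    by (intro borel_measurable_continuous_onI) (auto simp: gauss_def intro!: continuous_intros)
  fix k :: nat
  \<comment> \<open>The rate of decay of the scaled Gaussian in \<open>(norm x)\<^sup>2\<close>.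
    From 1 + r \<le> 2 + r^2 the polynomial factor is bounded by an exponential of the same rate,
    which the Gaussian cancels.\<close>
  define a where "a = \<epsilon>\<^sup>2 / 2"
  have a: "a > 0" using assms by (simp add: a_def)
  have "(1 + norm x) ^ k * norm (complex_of_real (gauss (\<epsilon> *\<^sub>R x))) \<le> fact k * exp (2 * a) / a ^ k"
    for x :: 'a
  proof -
    have "1 + norm x \<le> 2 + (norm x)\<^sup>2"
    proof -
      have "0 \<le> (norm x - 1)\<^sup>2" by simp
      also have "\<dots> = (norm x)\<^sup>2 + 1 - 2 * norm x" by (simp add: power2_diff)
      finally show ?thesis using norm_ge_zero[of x] by linarith
    qed
    then have "(a * (1 + norm x)) ^ k \<le> (a * (2 + (norm x)\<^sup>2)) ^ k"
      using a by (intro power_mono mult_left_mono) auto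
    also have "\<dots> \<le> fact k * exp (a * (2 + (norm x)\<^sup>2))"
      using a by (intro power_le_fact_exp) auto
    also have "\<dots> = fact k * exp (2 * a) * exp (a * (norm x)\<^sup>2)"
      by (simp add: distrib_left exp_add mult_ac)
    finally have "(a * (1 + norm x)) ^ k * exp (- (a * (norm x)\<^sup>2)) \<le>
        fact k * exp (2 * a) * exp (a * (norm x)\<^sup>2) * exp (- (a * (norm x)\<^sup>2))"
      by (rule mult_right_mono) simp
    also have "\<dots> = fact k * exp (2 * a)" by (simp add: exp_minus)
    also have "exp (- (a * (norm x)\<^sup>2)) = norm (complex_of_real (gauss (\<epsilon> *\<^sub>R x)))"
      by (simp add: gauss_def a_def power_mult_distrib)
    finally show ?thesis using a
      by (simp add: pos_le_divide_eq power_mult_distrib mult_ac)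
  qed
  then show "\<exists>C. \<forall>x::'a. (1 + norm x) ^ k * norm (complex_of_real (gauss (\<epsilon> *\<^sub>R x))) \<le> C"
    by blast
qed

section \<open>Schwartz functions obtained by Gaussian damping\<close>

text \<open>A family closed under directional derivatives: differentiating the Gaussian brings out a
  linear factor, and differentiating the inverse transform multiplies \<open>g\<close> by i times a
  linear form, which keeps it rapid. So every iterated partial derivative is under control without a
  formula for it.\<close>

inductive gauss_class :: "real \<Rightarrow> ('a::euclidean_space \<Rightarrow> complex) \<Rightarrow> bool" for \<epsilon> where
  base: "rapid g \<Longrightarrow> gauss_class \<epsilon> (\<lambda>x. inv_fourier g x * complex_of_real (gauss (\<epsilon> *\<^sub>R x)))"
| inner: "gauss_class \<epsilon> f \<Longrightarrow> gauss_class \<epsilon> (\<lambda>x. complex_of_real (c \<bullet> x) * f x)"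
| cmult: "gauss_class \<epsilon> f \<Longrightarrow> gauss_class \<epsilon> (\<lambda>x. a * f x)"
| add: "gauss_class \<epsilon> f \<Longrightarrow> gauss_class \<epsilon> g \<Longrightarrow> gauss_class \<epsilon> (\<lambda>x. f x + g x)"

lemma has_derivative_gauss_scaled:
  "((\<lambda>x. complex_of_real (gauss (\<epsilon> *\<^sub>R x))) has_derivative
     (\<lambda>h. - complex_of_real (\<epsilon>\<^sup>2) * (complex_of_real (h \<bullet> x) * complex_of_real (gauss (\<epsilon> *\<^sub>R x))))) (at x)"
proof -
  have eq: "gauss (\<epsilon> *\<^sub>R x) = exp (- (\<epsilon>\<^sup>2 * (x \<bullet> x) / 2))" for x :: 'a
    by (simp add: gauss_def power_mult_distrib power2_norm_eq_inner)
  have "((\<lambda>x. exp (- (\<epsilon>\<^sup>2 * (x \<bullet> x) / 2))) has_derivative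
      (\<lambda>h. exp (- (\<epsilon>\<^sup>2 * (x \<bullet> x) / 2)) * (- (\<epsilon>\<^sup>2 * (h \<bullet> x))))) (at x)"
    by (auto intro!: derivative_eq_intros simp: inner_commute)
  from has_derivative_of_real[OF this] show ?thesis
    unfolding eq by (simp add: mult_ac)
qed

lemma gauss_class_has_derivative:
  assumes "gauss_class \<epsilon> f"
  shows "\<exists>f'. (\<forall>x. (f has_derivative f' x) (at x)) \<and> (\<forall>b. gauss_class \<epsilon> (\<lambda>x. f' x b))"
  using assms
proof induction
  case (base g)
  let ?G = "\<lambda>x. complex_of_real (gauss (\<epsilon> *\<^sub>R x))"
  let ?f' = "\<lambda>x h. - complex_of_real (\<epsilon>\<^sup>2) * (complex_of_real (h \<bullet> x) * (inv_fourier g x * ?G x)) +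
     inv_fourier (\<lambda>\<xi>. \<i> * complex_of_real (h \<bullet> \<xi>) * g \<xi>) x * ?G x"
  have "((\<lambda>x. inv_fourier g x * ?G x) has_derivative ?f' x) (at x)" for x
    using has_derivative_mult[OF inv_fourier_has_derivative[OF base, of x] has_derivative_gauss_scaled[of \<epsilon> x]]
    by (simp add: mult_ac)
  moreover have "gauss_class \<epsilon> (\<lambda>x. ?f' x b)" for b
    by (intro gauss_class.intros base rapid_times_ii_inner)
  ultimately show ?case by (intro exI[of _ ?f']) blast
next
  case (inner f c)
  then obtain f' where f': "\<And>x. (f has_derivative f' x) (at x)" "\<And>b. gauss_class \<epsilon> (\<lambda>x. f' x b)"
    by blast
  have "((\<lambda>x. complex_of_real (c \<bullet> x) * f x) has_derivative
      (\<lambda>h. complex_of_real (c \<bullet> x) * f' x h + complex_of_real (c \<bullet> h) * f x)) (at x)" for x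
    by (intro has_derivative_mult f' has_derivative_of_real has_derivative_inner_right has_derivative_ident)
  moreover have "gauss_class \<epsilon> (\<lambda>x. complex_of_real (c \<bullet> x) * f' x b + complex_of_real (c \<bullet> b) * f x)" for b
    by (intro gauss_class.intros f' inner)
  ultimately show ?case
    by (intro exI[of _ "\<lambda>x h. complex_of_real (c \<bullet> x) * f' x h + complex_of_real (c \<bullet> h) * f x"]) blast
next
  case (cmult f a)
  then obtain f' where f': "\<And>x. (f has_derivative f' x) (at x)" "\<And>b. gauss_class \<epsilon> (\<lambda>x. f' x b)"
    by blast
  then show ?case
    by (intro exI[of _ "\<lambda>x h. a * f' x h"] conjI allI has_derivative_mult_right gauss_class.intros)
next
  case (add f g)
  then obtain f' g' where f': "\<And>x. (f has_derivative f' x) (at x)" "\<And>b. gauss_class \<epsilon> (\<lambda>x. f' x b)"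
    and g': "\<And>x. (g has_derivative g' x) (at x)" "\<And>b. gauss_class \<epsilon> (\<lambda>x. g' x b)"
    by blast
  then show ?case
    by (intro exI[of _ "\<lambda>x h. f' x h + g' x h"] conjI allI has_derivative_add gauss_class.intros)
qed

lemma gauss_class_rapid:
  assumes "gauss_class \<epsilon> f" "\<epsilon> > 0"
  shows "rapid f"
  using assms(1)
proof induction
  case (base g)
  have g: "integrable lborel g" using base by (rule rapid_integrable)
  have "norm (inv_fourier g x) \<le> norm (complex_of_real (1 / (2 * pi) ^ DIM('a))) * (LINT \<xi>|lborel. norm (g \<xi>))" for x :: 'a
    unfolding inv_fourier_eq norm_mult by (intro mult_left_mono norm_fourier_le g) auto
  then show ?case
    using continuous_on_inv_fourier[OF g]
    by (intro rapid_times_bounded rapid_gauss_scaled assms borel_measurable_continuous_onI)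
next
  case (cmult f a)
  then show ?case by (intro rapid_times_bounded[where B="norm a"]) auto
qed (auto intro: rapid_times_inner rapid_add)

lemma gauss_class_schwartz:
  assumes f: "gauss_class \<epsilon> f" and "\<epsilon> > 0"
  shows "schwartz f"
proof -
  have cl: "gauss_class \<epsilon> (iter_partial bs f)" for bs
  proof (induction bs)
    case (Cons b bs)
    from gauss_class_has_derivative[OF Cons] obtain f' where
      f': "\<And>x. (iter_partial bs f has_derivative f' x) (at x)" "gauss_class \<epsilon> (\<lambda>x. f' x b)"
      by blast
    then show ?case
      by (simp add: partial_deriv_def[abs_def] frechet_derivative_at[OF f'(1), symmetric])
  qed (simp add: f)
  show ?thesis unfolding schwartz_def
  proof (intro ballI conjI)
    fix bs :: "'a list"
    show "iter_partial bs f differentiable_on UNIV"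
      using gauss_class_has_derivative[OF cl[of bs]]
      by (auto simp: differentiable_on_def differentiable_def)
    show "\<forall>k. \<exists>C. \<forall>x. (1 + norm x) ^ k * norm (iter_partial bs f x) \<le> C"
      using gauss_class_rapid[OF cl[of bs] assms(2)] by (simp add: rapid_def)
  qed
qed

lemma
  shows integrable_gauss_real: "integrable lborel (\<lambda>t::real. exp (- (t\<^sup>2 / 2)))"
    and integral_gauss_exp_real: "(LINT t|lborel. complex_of_real (exp (- (t\<^sup>2 / 2))) * exp (- (\<i> * complex_of_real (t * s)))) =
      complex_of_real (sqrt (2 * pi) * exp (- (s\<^sup>2 / 2)))"
proof -
  have eq: "exp (- (t\<^sup>2 / 2)) = sqrt (2 * pi) * std_normal_density t" for t
    by (simp add: std_normal_density_def)
  show "integrable lborel (\<lambda>t::real. exp (- (t\<^sup>2 / 2)))"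
    unfolding eq by (intro integrable_mult_right integrable_normal_density) auto
  \<comment> \<open>The characteristic function of the standard normal distribution, taken at
    \<open>- s\<close> because its kernel has the opposite sign in the exponent.\<close>
  have "(LINT t|lborel. std_normal_density t *\<^sub>R iexp (- s * t)) = complex_of_real (exp (- (s\<^sup>2 / 2)))"
    using fun_cong[OF char_std_normal_distribution, of "- s"]
    by (simp add: char_def integral_density normal_density_nonneg)
  then have "complex_of_real (sqrt (2 * pi)) * (LINT t|lborel. std_normal_density t *\<^sub>R iexp (- s * t)) =
     complex_of_real (sqrt (2 * pi) * exp (- (s\<^sup>2 / 2)))" by simp
  then show "(LINT t|lborel. complex_of_real (exp (- (t\<^sup>2 / 2))) * exp (- (\<i> * complex_of_real (t * s)))) =
      complex_of_real (sqrt (2 * pi) * exp (- (s\<^sup>2 / 2)))"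
    unfolding eq by (subst (asm) integral_mult_right_zero[symmetric]) (simp add: scaleR_conv_of_real mult_ac)
qed

lemma norm_power2_eq_sum: "(norm (x::'a::euclidean_space))\<^sup>2 = (\<Sum>b\<in>Basis. (x \<bullet> b)\<^sup>2)"
  unfolding power2_norm_eq_inner by (subst euclidean_inner) (simp add: power2_eq_square)

lemma gauss_eq_prod: "gauss x = (\<Prod>b\<in>Basis. exp (- ((x \<bullet> b)\<^sup>2 / 2)))"
  by (simp add: gauss_def norm_power2_eq_sum exp_sum sum_divide_distrib sum_negf[symmetric])

lemma integrable_gauss: "integrable lborel gauss"
  unfolding gauss_eq_prod[abs_def]
  by (rule integrable_lborel_prod) (rule integrable_gauss_real)

lemma fourier_gauss:
  fixes \<xi> :: "'a::euclidean_space"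
  shows "fourier (\<lambda>x. complex_of_real (gauss x)) \<xi> = complex_of_real (sqrt (2 * pi) ^ DIM('a) * gauss \<xi>)"
proof -
  let ?f = "\<lambda>(b::'a) t. complex_of_real (exp (- (t\<^sup>2 / 2))) * exp (- (\<i> * complex_of_real (t * (\<xi> \<bullet> b))))"
  have 1: "complex_of_real (gauss x) * exp (- (\<i> * complex_of_real (x \<bullet> \<xi>))) = (\<Prod>b\<in>Basis. ?f b (x \<bullet> b))" for x
    by (simp add: gauss_eq_prod prod.distrib euclidean_inner[of x \<xi>] exp_sum sum_distrib_left sum_negf[symmetric])
  have 2: "integrable lborel (?f b)" for b :: 'a
    by (rule Bochner_Integration.integrable_bound[OF integrable_gauss_real]) (auto simp: norm_mult)
  show ?thesis
    unfolding fourier_def 1 integral_lborel_prod[OF 2, where ?'a='a] integral_gauss_exp_real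
    by (simp add: gauss_eq_prod prod.distrib)
qed

lemma integral_gauss: "(LINT x|lborel. gauss (x::'a::euclidean_space)) = sqrt (2 * pi) ^ DIM('a)"
proof -
  have "complex_of_real (LINT x|lborel. gauss (x::'a)) = complex_of_real (sqrt (2 * pi) ^ DIM('a))"
    using fourier_gauss[of "0::'a"] integral_complex_of_real[of lborel "gauss :: 'a \<Rightarrow> real"]
    unfolding fourier_def by (simp add: gauss_def[of "0::'a"])
  then show ?thesis by (simp only: of_real_eq_iff)
qed

lemma fourier_gauss_scaled:
  fixes \<zeta> :: "'a::euclidean_space"
  assumes "\<epsilon> > 0"
  shows "fourier (\<lambda>x. complex_of_real (gauss (\<epsilon> *\<^sub>R x))) \<zeta> =
    complex_of_real ((sqrt (2 * pi) / \<epsilon>) ^ DIM('a) * gauss ((1 / \<epsilon>) *\<^sub>R \<zeta>))"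
proof -
  have int: "integrable lborel (\<lambda>x. complex_of_real (gauss (\<epsilon> *\<^sub>R x)) * exp (- (\<i> * complex_of_real (x \<bullet> \<zeta>))))"
    using rapid_integrable[OF rapid_gauss_scaled[OF assms]] by (rule integrable_fourier_integrand)
  have "fourier (\<lambda>x. complex_of_real (gauss (\<epsilon> *\<^sub>R x))) \<zeta> =
      (1 / \<epsilon>) ^ DIM('a) *\<^sub>R fourier (\<lambda>x. complex_of_real (gauss x)) ((1 / \<epsilon>) *\<^sub>R \<zeta>)"
    unfolding fourier_def
    using integral_lborel_affine[OF _ int, of "1 / \<epsilon>" 0] assms by simp
  then show ?thesis
    unfolding fourier_gauss by (simp add: scaleR_conv_of_real power_divide)
qed

section \<open>Gaussian means and Fourier inversion\<close>

text \<open>The average of \<open>F\<close> over a Gaussian probability measure of width \<epsilon>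
  centred at \<zeta>. With \<epsilon> inside the argument of \<open>F\<close> the measure stays
  fixed, and the limit \<epsilon> \<rightarrow> 0 is dominated convergence for bounded continuous
  \<open>F\<close>.\<close>

definition gauss_mean :: "real \<Rightarrow> ('a::euclidean_space \<Rightarrow> complex) \<Rightarrow> 'a \<Rightarrow> complex" where
  "gauss_mean \<epsilon> F \<zeta> =
     (LINT \<eta>|lborel. F (\<zeta> + \<epsilon> *\<^sub>R \<eta>) * complex_of_real (gauss \<eta>)) / complex_of_real (sqrt (2 * pi) ^ DIM('a))"

lemma abs_gauss [simp]: "\<bar>gauss x\<bar> = gauss x"
  and gauss_nonneg [simp]: "0 \<le> gauss x"
  using gauss_pos[of x] by auto

lemma borel_measurable_gauss [measurable]: "gauss \<in> borel_measurable borel"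
  using borel_measurable_integrable[OF integrable_gauss] by simp

text \<open>Fubini for an integrable weight against kernels of uniformly bounded L^1 norm. The later
  uses take for \<open>K\<close> a fixed integrable function, modulated or translated by
  \<open>y\<close>, possibly times a bounded one.\<close>

lemma integral_kernel_swap:
  fixes g :: "'a::euclidean_space \<Rightarrow> complex" and K :: "'a \<Rightarrow> 'b::euclidean_space \<Rightarrow> complex"
  assumes g: "integrable lborel g"
    and K [measurable]: "(\<lambda>(y, x). K y x) \<in> borel_measurable (lborel \<Otimes>\<^sub>M lborel)"
    and int: "\<And>y. integrable lborel (K y)" and le: "\<And>y. (LINT x|lborel. norm (K y x)) \<le> B"
  shows "(LINT x|lborel. LINT y|lborel. g y * K y x) = (LINT y|lborel. g y * (LINT x|lborel. K y x))"
proof -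
  have [measurable]: "g \<in> borel_measurable lborel" using g by (rule borel_measurable_integrable)
  have [measurable]: "(\<lambda>p. K (fst p) (snd p)) \<in> borel_measurable (lborel \<Otimes>\<^sub>M lborel)"
    using K by (simp add: case_prod_beta')
  have "integrable (lborel \<Otimes>\<^sub>M lborel) (\<lambda>(y, x). g y * K y x)"
  proof (rule lborel_pair.Fubini_integrable)
    have "integrable lborel (\<lambda>y. norm (g y) * (LINT x|lborel. norm (K y x)))"
    proof (rule Bochner_Integration.integrable_bound)
      show "integrable lborel (\<lambda>y. B * norm (g y))" using g by simp
      show "AE y in lborel. norm (norm (g y) * (LINT x|lborel. norm (K y x))) \<le> norm (B * norm (g y))"
      proof (rule AE_I2)
        fix y
        have 0: "0 \<le> (LINT x|lborel. norm (K y x))" by simp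
        then have "norm (norm (g y) * (LINT x|lborel. norm (K y x))) = norm (g y) * (LINT x|lborel. norm (K y x))"
          by (simp add: abs_mult)
        also have "\<dots> \<le> norm (g y) * B" using le[of y] by (intro mult_left_mono) auto
        also have "\<dots> = norm (B * norm (g y))" using order_trans[OF 0 le[of y]] by (simp add: abs_mult)
        finally show "norm (norm (g y) * (LINT x|lborel. norm (K y x))) \<le> norm (B * norm (g y))" .
      qed
    qed measurable
    then show "integrable lborel (\<lambda>y. LINT x|lborel. norm (case (y, x) of (y, x) \<Rightarrow> g y * K y x))"
      by (simp add: norm_mult)
    show "AE y in lborel. integrable lborel (\<lambda>x. case (y, x) of (y, x) \<Rightarrow> g y * K y x)"
      using int by simp
  qed measurable
  from lborel_pair.Fubini_integral[OF this] show ?thesis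
    by simp
qed

text \<open>Both sides are the same double integral against a symmetric exponential. It moves the
  transform from \<open>f\<close> to the other factor, a damping Gaussian or a symbol.\<close>

lemma fourier_multiplication_formula:
  fixes f g :: "'a::euclidean_space \<Rightarrow> complex"
  assumes f: "integrable lborel f" and g: "integrable lborel g"
  shows "(LINT \<xi>|lborel. fourier f \<xi> * g \<xi>) = (LINT y|lborel. f y * fourier g y)"
proof -
  have [measurable]: "f \<in> borel_measurable borel" "g \<in> borel_measurable borel"
    using borel_measurable_integrable[OF f] borel_measurable_integrable[OF g] by auto
  let ?K = "\<lambda>y \<xi>. g \<xi> * exp (- (\<i> * complex_of_real (\<xi> \<bullet> y)))"
  have "(LINT \<xi>|lborel. fourier f \<xi> * g \<xi>) = (LINT \<xi>|lborel. LINT y|lborel. f y * ?K y \<xi>)"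
    unfolding fourier_def integral_mult_left_zero[symmetric] by (simp add: mult_ac inner_commute)
  also have "\<dots> = (LINT y|lborel. f y * (LINT \<xi>|lborel. ?K y \<xi>))"
    by (rule integral_kernel_swap[where B="LINT x|lborel. norm (g x)"])
       (use f g in \<open>auto intro: integrable_fourier_integrand simp: norm_mult\<close>)
  also have "\<dots> = (LINT y|lborel. f y * fourier g y)"
    by (simp add: fourier_def)
  finally show ?thesis .
qed

lemma fourier_modulate:
  "fourier (\<lambda>\<xi>. g \<xi> * exp (\<i> * complex_of_real (x \<bullet> \<xi>))) y = fourier g (y - x)"
  unfolding fourier_def
  by (intro Bochner_Integration.integral_cong)
     (simp_all add: inner_diff_right inner_diff_left exp_add[symmetric] exp_diff exp_minus field_simps inner_commute)

lemma gauss_mean_integrable: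
  fixes F :: "'a::euclidean_space \<Rightarrow> complex"
  assumes [measurable]: "F \<in> borel_measurable borel" and F: "\<And>x. norm (F x) \<le> B"
  shows "integrable lborel (\<lambda>\<eta>. F (\<zeta> + \<epsilon> *\<^sub>R \<eta>) * complex_of_real (gauss \<eta>))"
proof (rule Bochner_Integration.integrable_bound)
  show "integrable lborel (\<lambda>\<eta>::'a. B * gauss \<eta>)" by (intro integrable_mult_right integrable_gauss)
  show "(\<lambda>\<eta>. F (\<zeta> + \<epsilon> *\<^sub>R \<eta>) * complex_of_real (gauss \<eta>)) \<in> borel_measurable lborel"
    by measurable
  have "B \<ge> 0" using order_trans[OF norm_ge_zero F] .
  then show "AE \<eta> in lborel. norm (F (\<zeta> + \<epsilon> *\<^sub>R \<eta>) * complex_of_real (gauss \<eta>)) \<le> norm (B * gauss \<eta>)"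
    using F by (intro AE_I2) (auto simp: norm_mult abs_mult intro!: mult_right_mono)
qed

lemma norm_gauss_mean_le:
  fixes F :: "'a::euclidean_space \<Rightarrow> complex"
  assumes [measurable]: "F \<in> borel_measurable borel" and F: "\<And>x. norm (F x) \<le> B"
  shows "norm (gauss_mean \<epsilon> F \<zeta>) \<le> B"
proof -
  have "norm (LINT \<eta>|lborel. F (\<zeta> + \<epsilon> *\<^sub>R \<eta>) * complex_of_real (gauss \<eta>)) \<le> (LINT \<eta>|lborel. B * gauss (\<eta>::'a))"
    using F
    by (intro Bochner_Integration.integral_norm_bound_integral gauss_mean_integrable[OF assms] integrable_mult_right integrable_gauss)
       (auto simp: norm_mult intro!: mult_right_mono)
  then show ?thesis
    by (simp add: gauss_mean_def norm_divide norm_power integral_gauss pos_divide_le_eq)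
qed

lemma gauss_mean_tendsto:
  fixes F :: "'a::euclidean_space \<Rightarrow> complex"
  assumes cont: "continuous_on UNIV F" and F: "\<And>x. norm (F x) \<le> B" and \<epsilon>: "\<epsilon> \<longlonglongrightarrow> 0"
  shows "(\<lambda>n. gauss_mean (\<epsilon> n) F \<zeta>) \<longlonglongrightarrow> F \<zeta>"
proof -
  have [measurable]: "F \<in> borel_measurable borel" using cont by (rule borel_measurable_continuous_onI)
  have "(\<lambda>n. LINT \<eta>|lborel. F (\<zeta> + \<epsilon> n *\<^sub>R \<eta>) * complex_of_real (gauss \<eta>)) \<longlonglongrightarrow>
      (LINT \<eta>|lborel. F \<zeta> * complex_of_real (gauss (\<eta>::'a)))"
  proof (rule integral_dominated_convergence[where w="\<lambda>\<eta>::'a. B * gauss \<eta>"])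
    show "integrable lborel (\<lambda>\<eta>::'a. B * gauss \<eta>)" by (intro integrable_mult_right integrable_gauss)
    show "AE \<eta> in lborel. (\<lambda>n. F (\<zeta> + \<epsilon> n *\<^sub>R \<eta>) * complex_of_real (gauss \<eta>)) \<longlonglongrightarrow> F \<zeta> * complex_of_real (gauss \<eta>)"
    proof (intro AE_I2 tendsto_mult tendsto_const)
      fix \<eta> :: 'a
      have "(\<lambda>n. \<zeta> + \<epsilon> n *\<^sub>R \<eta>) \<longlonglongrightarrow> \<zeta> + 0 *\<^sub>R \<eta>" by (intro tendsto_intros \<epsilon>)
      then show "(\<lambda>n. F (\<zeta> + \<epsilon> n *\<^sub>R \<eta>)) \<longlonglongrightarrow> F \<zeta>"
        using cont by (intro continuous_on_tendsto_compose[OF cont]) auto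
    qed
    show "AE \<eta> in lborel. norm (F (\<zeta> + \<epsilon> n *\<^sub>R \<eta>) * complex_of_real (gauss \<eta>)) \<le> B * gauss \<eta>" for n
      using F by (intro AE_I2) (auto simp: norm_mult intro!: mult_right_mono)
  qed auto
  also have "(LINT \<eta>|lborel. F \<zeta> * complex_of_real (gauss (\<eta>::'a))) = F \<zeta> * complex_of_real (sqrt (2 * pi) ^ DIM('a))"
    by (simp add: integral_gauss del: of_real_power)
  finally have "(\<lambda>n. (LINT \<eta>|lborel. F (\<zeta> + \<epsilon> n *\<^sub>R \<eta>) * complex_of_real (gauss \<eta>)) / complex_of_real (sqrt (2 * pi) ^ DIM('a)))
     \<longlonglongrightarrow> F \<zeta> * complex_of_real (sqrt (2 * pi) ^ DIM('a)) / complex_of_real (sqrt (2 * pi) ^ DIM('a))"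
    by (intro tendsto_divide tendsto_const) auto
  then show ?thesis unfolding gauss_mean_def by simp
qed

lemma integrable_fourier_gauss_scaled:
  fixes \<zeta> :: "'a::euclidean_space"
  assumes "\<epsilon> > 0"
  shows "integrable lborel (\<lambda>\<xi>. fourier (\<lambda>x. complex_of_real (gauss (\<epsilon> *\<^sub>R x))) (\<xi> - \<zeta>))"
  unfolding fourier_gauss_scaled[OF assms]
  using integrable_lborel_affine[OF _ integrable_gauss, of "1 / \<epsilon>" "- ((1 / \<epsilon>) *\<^sub>R \<zeta>)"] assms
  by (intro integrable_of_real integrable_mult_right) (simp add: scaleR_diff_right)

text \<open>The transform of a Gaussian scaled by \<epsilon> is a peak of width \<epsilon>, and
  \<xi> = \<zeta> + \<epsilon> \<eta> rescales it to unit width. The powers of \<epsilon> cancel;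
  the factor \<open>sqrt (2 * pi) ^ DIM('a)\<close> occurs once in the transform and once in the
  mean, which matches the constant of \<open>inv_fourier\<close>.\<close>

lemma gauss_mean_eq:
  fixes F :: "'a::euclidean_space \<Rightarrow> complex"
  assumes [measurable]: "F \<in> borel_measurable borel" and F: "\<And>x. norm (F x) \<le> B" and \<epsilon>: "\<epsilon> > 0"
  shows "complex_of_real (1 / (2 * pi) ^ DIM('a)) *
      (LINT \<xi>|lborel. F \<xi> * fourier (\<lambda>x. complex_of_real (gauss (\<epsilon> *\<^sub>R x))) (\<xi> - \<zeta>)) = gauss_mean \<epsilon> F \<zeta>"
proof -
  let ?k = "\<lambda>\<xi>. fourier (\<lambda>x. complex_of_real (gauss (\<epsilon> *\<^sub>R x))) (\<xi> - \<zeta>)"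
  note k = integrable_fourier_gauss_scaled[OF \<epsilon>, of \<zeta>]
  have "integrable lborel (\<lambda>\<xi>. F \<xi> * ?k \<xi>)"
  proof (rule Bochner_Integration.integrable_bound)
    show "integrable lborel (\<lambda>\<xi>. B * norm (?k \<xi>))" using k by simp
    show "(\<lambda>\<xi>. F \<xi> * ?k \<xi>) \<in> borel_measurable lborel"
      using borel_measurable_integrable[OF k] by simp
    have B: "B \<ge> 0" using order_trans[OF norm_ge_zero F] .
    show "AE \<xi> in lborel. norm (F \<xi> * ?k \<xi>) \<le> norm (B * norm (?k \<xi>))"
      unfolding norm_mult real_norm_def abs_mult abs_of_nonneg[OF B] abs_norm_cancel
      by (intro AE_I2 mult_right_mono) (simp_all add: F)
  qed
  from integral_lborel_affine[OF _ this, of \<epsilon> \<zeta>]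
  have eq1: "(LINT \<xi>|lborel. F \<xi> * ?k \<xi>) = \<epsilon> ^ DIM('a) *\<^sub>R (LINT x|lborel. F (\<zeta> + \<epsilon> *\<^sub>R x) * ?k (\<zeta> + \<epsilon> *\<^sub>R x))"
    using \<epsilon> by simp
  have "(LINT x|lborel. F (\<zeta> + \<epsilon> *\<^sub>R x) * ?k (\<zeta> + \<epsilon> *\<^sub>R x)) =
      (LINT x|lborel. complex_of_real ((sqrt (2 * pi) / \<epsilon>) ^ DIM('a)) * (F (\<zeta> + \<epsilon> *\<^sub>R x) * complex_of_real (gauss x)))"
    using \<epsilon> by (intro Bochner_Integration.integral_cong) (auto simp: fourier_gauss_scaled)
  also have "\<dots> = complex_of_real ((sqrt (2 * pi) / \<epsilon>) ^ DIM('a)) *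
      (gauss_mean \<epsilon> F \<zeta> * complex_of_real (sqrt (2 * pi) ^ DIM('a)))"
    by (simp add: gauss_mean_def)
  finally have eq2: "(LINT x|lborel. F (\<zeta> + \<epsilon> *\<^sub>R x) * ?k (\<zeta> + \<epsilon> *\<^sub>R x)) =
      complex_of_real ((sqrt (2 * pi) / \<epsilon>) ^ DIM('a)) *
      (gauss_mean \<epsilon> F \<zeta> * complex_of_real (sqrt (2 * pi) ^ DIM('a)))" .
  have *: "(LINT \<xi>|lborel. F \<xi> * ?k \<xi>) =
    complex_of_real (\<epsilon> ^ DIM('a) * (sqrt (2 * pi) / \<epsilon>) ^ DIM('a) * sqrt (2 * pi) ^ DIM('a)) * gauss_mean \<epsilon> F \<zeta>"
    unfolding eq1 eq2 scaleR_conv_of_real of_real_mult by (simp only: mult_ac)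
  have "\<epsilon> ^ DIM('a) * (sqrt (2 * pi) / \<epsilon>) ^ DIM('a) * sqrt (2 * pi) ^ DIM('a) = (2 * pi) ^ DIM('a)"
  proof -
    have "\<epsilon> * (sqrt (2 * pi) / \<epsilon>) * sqrt (2 * pi) = 2 * pi" using \<epsilon> by simp
    then show ?thesis unfolding power_mult_distrib[symmetric] by simp
  qed
  then show ?thesis unfolding * by simp
qed

lemma inverse_Suc_tendsto_0: "(\<lambda>n. inverse (real (Suc n))) \<longlonglongrightarrow> 0"
  by (rule LIMSEQ_inverse_real_of_nat)

text \<open>Damping \<open>fourier f\<close> by \<open>gauss (\<epsilon> \<xi>)\<close> turns its inverse transform into a Gaussian mean of \<open>f\<close>.\<close>

lemma fourier_inversion:
  fixes f :: "'a::euclidean_space \<Rightarrow> complex"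
  assumes f: "schwartz f"
  shows "inv_fourier (fourier f) x = f x"
proof -
  let ?\<epsilon> = "\<lambda>n. inverse (real (Suc n))"
  let ?g = "\<lambda>n \<xi>. complex_of_real (gauss (?\<epsilon> n *\<^sub>R \<xi>))"
  let ?e = "\<lambda>\<xi>. exp (\<i> * complex_of_real (x \<bullet> \<xi>))"
  have intf: "integrable lborel f" using rapid_integrable[OF schwartz_rapid[OF f]] .
  have intF: "integrable lborel (fourier f)" using rapid_integrable[OF rapid_fourier[OF f]] .
  have [measurable]: "f \<in> borel_measurable borel" "fourier f \<in> borel_measurable borel"
    using borel_measurable_integrable[OF intf] borel_measurable_integrable[OF intF] by auto
  obtain B where B: "\<And>x. norm (f x) \<le> B" using rapid_bounded[OF schwartz_rapid[OF f]] by blast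
  have eq: "complex_of_real (1 / (2 * pi) ^ DIM('a)) * (LINT \<xi>|lborel. fourier f \<xi> * (?g n \<xi> * ?e \<xi>)) =
      gauss_mean (?\<epsilon> n) f x" for n
  proof -
    have "(LINT \<xi>|lborel. fourier f \<xi> * (?g n \<xi> * ?e \<xi>)) = (LINT y|lborel. f y * fourier (?g n) (y - x))"
      unfolding fourier_modulate[symmetric]
      by (intro fourier_multiplication_formula intf integrable_inv_fourier_integrand rapid_integrable rapid_gauss_scaled) simp
    then show ?thesis using gauss_mean_eq[where F=f and B=B and \<epsilon>="?\<epsilon> n" and \<zeta>=x] B by simp
  qed
  have "(\<lambda>n. LINT \<xi>|lborel. fourier f \<xi> * (?g n \<xi> * ?e \<xi>)) \<longlonglongrightarrow> (LINT \<xi>|lborel. fourier f \<xi> * ?e \<xi>)"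
  proof (rule integral_dominated_convergence[where w="\<lambda>\<xi>. norm (fourier f \<xi>)"])
    show "AE \<xi> in lborel. (\<lambda>n. fourier f \<xi> * (?g n \<xi> * ?e \<xi>)) \<longlonglongrightarrow> fourier f \<xi> * ?e \<xi>"
    proof (rule AE_I2)
      fix \<xi> :: 'a
      have "(\<lambda>n. exp (- ((norm (?\<epsilon> n *\<^sub>R \<xi>))\<^sup>2 / 2))) \<longlonglongrightarrow> exp (- ((norm (0 *\<^sub>R \<xi>))\<^sup>2 / 2))"
        by (intro tendsto_intros inverse_Suc_tendsto_0) auto
      then have "(\<lambda>n. fourier f \<xi> * (?g n \<xi> * ?e \<xi>)) \<longlonglongrightarrow> fourier f \<xi> * (complex_of_real 1 * ?e \<xi>)"
        unfolding gauss_def by (intro tendsto_intros) simp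
      then show "(\<lambda>n. fourier f \<xi> * (?g n \<xi> * ?e \<xi>)) \<longlonglongrightarrow> fourier f \<xi> * ?e \<xi>" by simp
    qed
    show "AE \<xi> in lborel. norm (fourier f \<xi> * (?g n \<xi> * ?e \<xi>)) \<le> norm (fourier f \<xi>)" for n
      by (intro AE_I2) (simp add: norm_mult mult_left_le gauss_le_1)
  qed (use intF in auto)
  then have "(\<lambda>n. complex_of_real (1 / (2 * pi) ^ DIM('a)) * (LINT \<xi>|lborel. fourier f \<xi> * (?g n \<xi> * ?e \<xi>)))
      \<longlonglongrightarrow> inv_fourier (fourier f) x"
    unfolding inv_fourier_def by (intro tendsto_mult tendsto_const)
  then have lim: "(\<lambda>n. gauss_mean (?\<epsilon> n) f x) \<longlonglongrightarrow> inv_fourier (fourier f) x" unfolding eq .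
  have "(\<lambda>n. gauss_mean (?\<epsilon> n) f x) \<longlonglongrightarrow> f x"
    by (rule gauss_mean_tendsto[OF schwartz_continuous[OF f] B inverse_Suc_tendsto_0])
  with lim show ?thesis by (rule LIMSEQ_unique)
qed

section \<open>The algebra of multiplier symbols\<close>

text \<open>The p-th power of the norm. Without the root, monotonicity, Fatou and Tonelli apply
  directly; constants turn into their p-th powers, which is harmless for boundedness.\<close>

definition Lp_int :: "real \<Rightarrow> ('a::euclidean_space \<Rightarrow> complex) \<Rightarrow> ennreal" where
  "Lp_int p f = (\<integral>\<^sup>+ x. ennreal (norm (f x) powr p) \<partial>lborel)"

text \<open>Continuity is included because products are reached through Gaussian means of a symbol,
  which converge back to it pointwise when it is continuous; the bound supplies the
  majorant.\<close>

definition Lp_symbol :: "real \<Rightarrow> ('a::euclidean_space \<Rightarrow> complex) \<Rightarrow> bool" where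
  "Lp_symbol p m \<longleftrightarrow> continuous_on UNIV m \<and> (\<exists>B. \<forall>\<xi>. norm (m \<xi>) \<le> B) \<and>
     (\<exists>C::real. 0 \<le> C \<and> (\<forall>f. schwartz f \<longrightarrow> Lp_int p (fourier_multiplier m f) \<le> ennreal C * Lp_int p f))"

lemma Lp_int_schwartz_finite:
  fixes f :: "'a::euclidean_space \<Rightarrow> complex"
  assumes f: "schwartz f" and p: "1 \<le> p"
  shows "Lp_int p f < \<infinity>"
proof -
  note r = schwartz_rapid[OF f]
  have [measurable]: "f \<in> borel_measurable borel" using r by (simp add: rapid_def)
  obtain B where B: "\<And>x. norm (f x) \<le> B" using rapid_bounded[OF r] by blast
  \<comment> \<open>Boundedness of \<open>f\<close> reduces the p-th power to the first one; p \<ge>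
    1 makes the exponent p - 1 nonnegative.\<close>
  have "norm (f x) powr p \<le> B powr (p - 1) * norm (f x)" for x
  proof (cases "f x = 0")
    case False
    then have "norm (f x) powr p = norm (f x) powr (p - 1) * norm (f x)"
      using powr_add[of "norm (f x)" "p - 1" 1] by simp
    also have "\<dots> \<le> B powr (p - 1) * norm (f x)"
      using p B by (intro mult_right_mono powr_mono2) auto
    finally show ?thesis .
  qed simp
  then have "Lp_int p f \<le> (\<integral>\<^sup>+ x. ennreal (B powr (p - 1) * norm (f x)) \<partial>lborel)"
    unfolding Lp_int_def by (intro nn_integral_mono ennreal_leI)
  also have "\<dots> < \<infinity>"
  proof -
    have "integrable lborel (\<lambda>x. B powr (p - 1) * norm (f x))"
      using rapid_integrable[OF r] by simp
    then have "(\<integral>\<^sup>+ x. ennreal (norm (B powr (p - 1) * norm (f x))) \<partial>lborel) < \<infinity>"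
      unfolding integrable_iff_bounded by blast
    then show ?thesis by (simp add: abs_mult)
  qed
  finally show ?thesis .
qed

text \<open>Raise to the power p or 1 / p. As the integral of a Schwartz function is finite, either
  bound excludes an infinite value on the left.\<close>

lemma bounded_on_Lp_iff:
  fixes T :: "('a::euclidean_space \<Rightarrow> complex) \<Rightarrow> 'a \<Rightarrow> complex"
  assumes p: "1 \<le> p"
  shows "bounded_on_Lp p T \<longleftrightarrow>
     (\<exists>C::real. 0 \<le> C \<and> (\<forall>f. schwartz f \<longrightarrow> Lp_int p (T f) \<le> ennreal C * Lp_int p f))"
proof
  assume "bounded_on_Lp p T"
  then obtain C where C: "0 \<le> C" "\<And>f. schwartz f \<Longrightarrow> Lp_norm p (T f) \<le> ennreal C * Lp_norm p f"
    unfolding bounded_on_Lp_def by blast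
  have "Lp_int p (T f) \<le> ennreal (C powr p) * Lp_int p f" if f: "schwartz f" for f
  proof -
    obtain a where a: "a \<ge> 0" "Lp_int p f = ennreal a"
      using Lp_int_schwartz_finite[OF f p] by (cases "Lp_int p f") auto
    then have Lf: "Lp_norm p f = ennreal (a powr (1 / p))"
      by (simp add: Lp_norm_def Lp_int_def[symmetric] Let_def)
    show ?thesis
    proof (cases "Lp_int p (T f)")
      case (real b)
      then have LT: "Lp_norm p (T f) = ennreal (b powr (1 / p))"
        by (simp add: Lp_norm_def Lp_int_def[symmetric] Let_def)
      have "b powr (1 / p) \<le> C * a powr (1 / p)"
        using C(2)[OF f] C(1) unfolding Lf LT by (simp add: ennreal_mult'[symmetric])
      then have "(b powr (1 / p)) powr p \<le> (C * a powr (1 / p)) powr p"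
        using p by (intro powr_mono2) auto
      then have "b \<le> C powr p * a"
        using p real a C(1) by (simp add: powr_mult powr_powr)
      then show ?thesis using real a by (simp add: ennreal_mult'[symmetric])
    next
      case top
      then have "Lp_norm p (T f) = \<infinity>"
        by (simp add: Lp_norm_def Lp_int_def[symmetric] Let_def)
      with C(2)[OF f] show ?thesis unfolding Lf
        by (simp add: ennreal_mult'[symmetric] C(1) top_unique)
    qed
  qed
  then show "\<exists>C::real. 0 \<le> C \<and> (\<forall>f. schwartz f \<longrightarrow> Lp_int p (T f) \<le> ennreal C * Lp_int p f)"
    by (intro exI[of _ "C powr p"]) auto
next
  assume "\<exists>C::real. 0 \<le> C \<and> (\<forall>f. schwartz f \<longrightarrow> Lp_int p (T f) \<le> ennreal C * Lp_int p f)"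
  then obtain C where C: "0 \<le> C" "\<And>f. schwartz f \<Longrightarrow> Lp_int p (T f) \<le> ennreal C * Lp_int p f"
    by blast
  have "Lp_norm p (T f) \<le> ennreal (C powr (1 / p)) * Lp_norm p f" if f: "schwartz f" for f
  proof -
    obtain a where a: "a \<ge> 0" "Lp_int p f = ennreal a"
      using Lp_int_schwartz_finite[OF f p] by (cases "Lp_int p f") auto
    then have Lf: "Lp_norm p f = ennreal (a powr (1 / p))"
      by (simp add: Lp_norm_def Lp_int_def[symmetric] Let_def)
    have le: "Lp_int p (T f) \<le> ennreal (C * a)"
      using C(2)[OF f] a C(1) by (simp add: ennreal_mult')
    show ?thesis
    proof (cases "Lp_int p (T f)")
      case (real b)
      then have LT: "Lp_norm p (T f) = ennreal (b powr (1 / p))"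
        by (simp add: Lp_norm_def Lp_int_def[symmetric] Let_def)
      have "b \<le> C * a" using le real a C(1) by (simp add: ennreal_le_iff)
      then have "b powr (1 / p) \<le> (C * a) powr (1 / p)"
        using p real by (intro powr_mono2) auto
      then show ?thesis unfolding LT Lf
        using a C(1) by (simp add: ennreal_mult'[symmetric] powr_mult ennreal_leI)
    next
      case top
      with le show ?thesis by (simp add: top_unique)
    qed
  qed
  then show "bounded_on_Lp p T"
    unfolding bounded_on_Lp_def by (intro exI[of _ "C powr (1 / p)"]) auto
qed

lemma Lp_symbolD:
  assumes "Lp_symbol p m"
  shows "continuous_on UNIV m" "m \<in> borel_measurable borel"
    and "\<exists>B. \<forall>\<xi>. norm (m \<xi>) \<le> B"
    and "\<exists>C::real. 0 \<le> C \<and> (\<forall>f. schwartz f \<longrightarrow> Lp_int p (fourier_multiplier m f) \<le> ennreal C * Lp_int p f)"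
  using assms by (auto simp: Lp_symbol_def borel_measurable_continuous_onI)

lemma rapid_symbol_times_fourier:
  assumes "m \<in> borel_measurable borel" "\<exists>B. \<forall>\<xi>. norm (m \<xi>) \<le> B" "schwartz f"
  shows "rapid (\<lambda>\<xi>. m \<xi> * fourier f \<xi>)"
  using assms rapid_times_bounded[OF rapid_fourier] by blast

lemma fourier_multiplier_measurable:
  assumes "m \<in> borel_measurable borel" "\<exists>B. \<forall>\<xi>. norm (m \<xi>) \<le> B" "schwartz f"
  shows "fourier_multiplier m f \<in> borel_measurable borel"
  unfolding fourier_multiplier_def
  by (intro borel_measurable_continuous_onI continuous_on_inv_fourier rapid_integrable
      rapid_symbol_times_fourier assms)

text \<open>Here Fourier inversion enters: through it the constant symbol acts on Schwartz functions
  as a scalar, so the algebra has a unit.\<close>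

lemma Lp_symbol_const:
  fixes a :: complex
  assumes "1 \<le> p"
  shows "Lp_symbol p (\<lambda>_::'a::euclidean_space. a)"
proof -
  have "Lp_int p (fourier_multiplier (\<lambda>_. a) f) = ennreal (norm a powr p) * Lp_int p f"
    if f: "schwartz f" for f :: "'a \<Rightarrow> complex"
  proof -
    have [measurable]: "f \<in> borel_measurable borel" using schwartz_rapid[OF f] by (simp add: rapid_def)
    have "fourier_multiplier (\<lambda>_. a) f x = a * inv_fourier (fourier f) x" for x
      by (simp add: fourier_multiplier_def inv_fourier_def mult.assoc)
    then show ?thesis
      by (simp add: Lp_int_def fourier_inversion[OF f] norm_mult powr_mult ennreal_mult' nn_integral_cmult)
  qed
  then have "\<exists>C::real. 0 \<le> C \<and> (\<forall>f::'a \<Rightarrow> complex. schwartz f \<longrightarrow>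
      Lp_int p (fourier_multiplier (\<lambda>_. a) f) \<le> ennreal C * Lp_int p f)"
    by (intro exI[of _ "norm a powr p"]) auto
  then show ?thesis
    unfolding Lp_symbol_def by auto
qed

text \<open>Takes the place of Minkowski's inequality; the loss is a constant factor.\<close>

lemma powr_add_le:
  fixes a b p :: real
  assumes "0 \<le> a" "0 \<le> b" "0 \<le> p"
  shows "(a + b) powr p \<le> 2 powr p * (a powr p + b powr p)"
proof -
  have "(a + b) powr p \<le> (2 * max a b) powr p"
    using assms by (intro powr_mono2) auto
  also have "\<dots> = 2 powr p * max a b powr p"
    using assms by (simp add: powr_mult)
  also have "\<dots> \<le> 2 powr p * (a powr p + b powr p)"
    by (intro mult_left_mono) (auto simp: max_def)
  finally show ?thesis .
qed

lemma Lp_symbol_add: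
  fixes m n :: "'a::euclidean_space \<Rightarrow> complex"
  assumes p: "1 \<le> p" and m: "Lp_symbol p m" and n: "Lp_symbol p n"
  shows "Lp_symbol p (\<lambda>\<xi>. m \<xi> + n \<xi>)"
proof -
  obtain C D where C: "0 \<le> C" "\<And>f. schwartz f \<Longrightarrow> Lp_int p (fourier_multiplier m f) \<le> ennreal C * Lp_int p f"
    and D: "0 \<le> D" "\<And>f. schwartz f \<Longrightarrow> Lp_int p (fourier_multiplier n f) \<le> ennreal D * Lp_int p f"
    using Lp_symbolD(4)[OF m] Lp_symbolD(4)[OF n] by blast
  obtain A B where A: "\<And>\<xi>. norm (m \<xi>) \<le> A" and B: "\<And>\<xi>. norm (n \<xi>) \<le> B"
    using Lp_symbolD(3)[OF m] Lp_symbolD(3)[OF n] by blast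
  have "Lp_int p (fourier_multiplier (\<lambda>\<xi>. m \<xi> + n \<xi>) f) \<le> ennreal (2 powr p * (C + D)) * Lp_int p f"
    if f: "schwartz f" for f
  proof -
    let ?M = "fourier_multiplier m f" and ?N = "fourier_multiplier n f"
    have [measurable]: "?M \<in> borel_measurable borel" "?N \<in> borel_measurable borel"
      using m n f by (auto intro: fourier_multiplier_measurable Lp_symbolD)
    have "fourier_multiplier (\<lambda>\<xi>. m \<xi> + n \<xi>) f x = ?M x + ?N x" for x
      using integrable_inv_fourier_integrand[OF rapid_integrable[OF rapid_symbol_times_fourier[OF Lp_symbolD(2,3)[OF m] f]], of x]
        integrable_inv_fourier_integrand[OF rapid_integrable[OF rapid_symbol_times_fourier[OF Lp_symbolD(2,3)[OF n] f]], of x]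
      by (simp add: fourier_multiplier_def inv_fourier_def distrib_right distrib_left)
    then have "Lp_int p (fourier_multiplier (\<lambda>\<xi>. m \<xi> + n \<xi>) f) \<le>
        (\<integral>\<^sup>+ x. ennreal (2 powr p) * (ennreal (norm (?M x) powr p) + ennreal (norm (?N x) powr p)) \<partial>lborel)"
      unfolding Lp_int_def
    proof (intro nn_integral_mono)
      fix x assume eq: "\<And>x. fourier_multiplier (\<lambda>\<xi>. m \<xi> + n \<xi>) f x = ?M x + ?N x"
      have "norm (?M x + ?N x) powr p \<le> (norm (?M x) + norm (?N x)) powr p"
        using p by (intro powr_mono2 norm_triangle_ineq) auto
      also have "\<dots> \<le> 2 powr p * (norm (?M x) powr p + norm (?N x) powr p)"
        using p by (intro powr_add_le) auto
      finally show "ennreal (norm (fourier_multiplier (\<lambda>\<xi>. m \<xi> + n \<xi>) f x) powr p) \<le>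
          ennreal (2 powr p) * (ennreal (norm (?M x) powr p) + ennreal (norm (?N x) powr p))"
        unfolding eq by (simp add: ennreal_mult'[symmetric] ennreal_plus[symmetric] ennreal_leI del: ennreal_plus)
    qed
    also have "\<dots> = ennreal (2 powr p) * (Lp_int p ?M + Lp_int p ?N)"
      unfolding Lp_int_def by (subst nn_integral_cmult) (auto simp: nn_integral_add)
    also have "\<dots> \<le> ennreal (2 powr p) * (ennreal C * Lp_int p f + ennreal D * Lp_int p f)"
      using C(2)[OF f] D(2)[OF f] by (intro mult_left_mono add_mono) auto
    also have "\<dots> = ennreal (2 powr p * (C + D)) * Lp_int p f"
      using C(1) D(1) by (simp add: ennreal_mult' distrib_right mult.assoc)
    finally show ?thesis .
  qed
  moreover have "norm (m \<xi> + n \<xi>) \<le> A + B" for \<xi>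
    using norm_triangle_ineq A B by (rule order_trans[OF _ add_mono])
  ultimately have "\<exists>C::real. 0 \<le> C \<and> (\<forall>f. schwartz f \<longrightarrow>
      Lp_int p (fourier_multiplier (\<lambda>\<xi>. m \<xi> + n \<xi>) f) \<le> ennreal C * Lp_int p f)"
    "\<exists>B. \<forall>\<xi>. norm (m \<xi> + n \<xi>) \<le> B"
    using C(1) D(1) by - (rule exI[of _ "2 powr p * (C + D)"], simp, rule exI[of _ "A + B"], blast)
  then show ?thesis
    unfolding Lp_symbol_def using Lp_symbolD(1)[OF m] Lp_symbolD(1)[OF n]
    by (auto intro: continuous_on_add)
qed

lemma Lp_int_Fatou:
  assumes meas: "\<And>n. u n \<in> borel_measurable borel" and lim: "\<And>x. (\<lambda>n. u n x) \<longlonglongrightarrow> v x"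
    and le: "\<And>n. Lp_int p (u n) \<le> c" and p: "0 < p"
  shows "Lp_int p v \<le> c"
proof -
  note [measurable] = meas
  have "(\<lambda>n. ennreal (norm (u n x) powr p)) \<longlonglongrightarrow> ennreal (norm (v x) powr p)" for x
    by (intro tendsto_ennrealI tendsto_powr' tendsto_norm lim tendsto_const) (use p in auto)
  then have "Lp_int p v = (\<integral>\<^sup>+ x. liminf (\<lambda>n. ennreal (norm (u n x) powr p)) \<partial>lborel)"
    unfolding Lp_int_def by (intro nn_integral_cong lim_imp_Liminf[symmetric]) auto
  also have "\<dots> \<le> liminf (\<lambda>n. Lp_int p (u n))"
    unfolding Lp_int_def by (intro nn_integral_liminf) auto
  also have "\<dots> \<le> liminf (\<lambda>n. c)"
    using le by (intro Liminf_mono) auto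
  also have "\<dots> = c" by (simp add: Liminf_const)
  finally show ?thesis .
qed

text \<open>Damping in x is convolution with a narrow Gaussian in \<xi>. The formula comes from
  Fubini, since inversion is established for Schwartz functions and \<open>g\<close> is merely
  integrable.\<close>

lemma fourier_inv_fourier_times_gauss:
  fixes g :: "'a::euclidean_space \<Rightarrow> complex"
  assumes g: "integrable lborel g" and \<epsilon>: "\<epsilon> > 0"
  shows "fourier (\<lambda>x. inv_fourier g x * complex_of_real (gauss (\<epsilon> *\<^sub>R x))) \<xi> =
    complex_of_real (1 / (2 * pi) ^ DIM('a)) *
      (LINT y|lborel. g y * fourier (\<lambda>x. complex_of_real (gauss (\<epsilon> *\<^sub>R x))) (\<xi> - y))"
proof -
  let ?c = "complex_of_real (1 / (2 * pi) ^ DIM('a))"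
  let ?G = "\<lambda>x::'a. complex_of_real (gauss (\<epsilon> *\<^sub>R x))"
  let ?K = "\<lambda>y x. ?G x * exp (- (\<i> * complex_of_real (x \<bullet> (\<xi> - y))))"
  have G: "integrable lborel ?G" by (rule rapid_integrable[OF rapid_gauss_scaled[OF \<epsilon>]])
  have e: "exp (\<i> * complex_of_real (x \<bullet> y)) * exp (- (\<i> * complex_of_real (x \<bullet> \<xi>))) =
      exp (- (\<i> * complex_of_real (x \<bullet> (\<xi> - y))))" for x y
    by (simp add: exp_add[symmetric] inner_diff_right right_diff_distrib)
  have "inv_fourier g x * ?G x * exp (- (\<i> * complex_of_real (x \<bullet> \<xi>))) = ?c * (LINT y|lborel. g y * ?K y x)" for x
  proof -
    have "inv_fourier g x * ?G x * exp (- (\<i> * complex_of_real (x \<bullet> \<xi>))) =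
        ?c * ((LINT y|lborel. g y * exp (\<i> * complex_of_real (x \<bullet> y))) * (?G x * exp (- (\<i> * complex_of_real (x \<bullet> \<xi>)))))"
      by (simp only: inv_fourier_def mult.assoc)
    also have "(LINT y|lborel. g y * exp (\<i> * complex_of_real (x \<bullet> y))) * (?G x * exp (- (\<i> * complex_of_real (x \<bullet> \<xi>)))) =
        (LINT y|lborel. g y * ?K y x)"
      unfolding integral_mult_left_zero[symmetric] e[symmetric] by (simp only: mult_ac)
    finally show ?thesis .
  qed
  then have "fourier (\<lambda>x. inv_fourier g x * ?G x) \<xi> = ?c * (LINT x|lborel. LINT y|lborel. g y * ?K y x)"
    unfolding fourier_def by simp
  also have "(LINT x|lborel. LINT y|lborel. g y * ?K y x) = (LINT y|lborel. g y * (LINT x|lborel. ?K y x))"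
    by (rule integral_kernel_swap[OF g, where B="LINT x|lborel. norm (?G x)"])
       (use G in \<open>auto intro: integrable_fourier_integrand simp: norm_mult\<close>)
  finally show ?thesis by (simp add: fourier_def)
qed

text \<open>Fubini shifts the smoothing from \<open>g\<close> onto the symbol times the character.
  As \<epsilon> \<rightarrow> 0 this mean tends to its value at y when \<open>m\<close> is
  continuous, so the formula tends to the multiplier acting on the undamped function.\<close>

lemma multiplier_times_gauss:
  fixes g :: "'a::euclidean_space \<Rightarrow> complex"
  assumes g: "integrable lborel g" and \<epsilon>: "\<epsilon> > 0"
    and [measurable]: "m \<in> borel_measurable borel" and m: "\<And>\<xi>. norm (m \<xi>) \<le> B"
  shows "fourier_multiplier m (\<lambda>x. inv_fourier g x * complex_of_real (gauss (\<epsilon> *\<^sub>R x))) x =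
    complex_of_real (1 / (2 * pi) ^ DIM('a)) *
      (LINT y|lborel. g y * gauss_mean \<epsilon> (\<lambda>\<xi>. m \<xi> * exp (\<i> * complex_of_real (x \<bullet> \<xi>))) y)"
proof -
  let ?c = "complex_of_real (1 / (2 * pi) ^ DIM('a))"
  define k where "k = fourier (\<lambda>x::'a. complex_of_real (gauss (\<epsilon> *\<^sub>R x)))"
  define F where "F \<xi> = m \<xi> * exp (\<i> * complex_of_real (x \<bullet> \<xi>))" for \<xi>
  have [measurable]: "F \<in> borel_measurable borel" unfolding F_def by measurable
  have F: "norm (F \<xi>) \<le> B" for \<xi> using m by (simp add: F_def norm_mult)
  have B: "B \<ge> 0" using order_trans[OF norm_ge_zero F] .
  have k: "integrable lborel (\<lambda>\<xi>. k (\<xi> - y))" for y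
    unfolding k_def by (rule integrable_fourier_gauss_scaled[OF \<epsilon>])
  from k[of 0] have k0: "integrable lborel k" by simp
  then have [measurable]: "k \<in> borel_measurable borel" using borel_measurable_integrable by fastforce
  have [measurable]: "(\<lambda>p. F (snd p) * k (snd p - fst p)) \<in> borel_measurable (lborel \<Otimes>\<^sub>M lborel)"
    by measurable
  have kB: "integrable lborel (\<lambda>\<xi>. B * norm (k (\<xi> - y)))" for y using k by simp
  have Fk_le: "norm (F \<xi> * k (\<xi> - y)) \<le> B * norm (k (\<xi> - y))" for \<xi> y
    unfolding norm_mult by (intro mult_right_mono F) simp
  have Fk: "integrable lborel (\<lambda>\<xi>. F \<xi> * k (\<xi> - y))" for y
  proof (rule Bochner_Integration.integrable_bound[OF kB])
    show "AE \<xi> in lborel. norm (F \<xi> * k (\<xi> - y)) \<le> norm (B * norm (k (\<xi> - y)))"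
      using Fk_le B by (intro AE_I2) (simp add: abs_mult)
  qed measurable
  have ck: "(LINT \<xi>|lborel. norm (k (\<xi> - y))) = (LINT \<xi>|lborel. norm (k \<xi>))" for y
    using integral_lborel_affine[OF _ integrable_norm[OF k0], of 1 "- y"] by simp
  \<comment> \<open>One factor \<open>?c\<close> belongs to the outer inverse transform, the other
    to the damped function; the latter is absorbed by the Gaussian mean.\<close>
  have "fourier_multiplier m (\<lambda>x. inv_fourier g x * complex_of_real (gauss (\<epsilon> *\<^sub>R x))) x =
      ?c * (LINT \<xi>|lborel. ?c * (LINT y|lborel. g y * (F \<xi> * k (\<xi> - y))))"
    unfolding fourier_multiplier_def fourier_inv_fourier_times_gauss[OF g \<epsilon>] inv_fourier_def[of _ x]
      integral_mult_right_zero[symmetric]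
    by (simp only: k_def F_def mult_ac integral_mult_right_zero[symmetric])
  also have "\<dots> = ?c * (?c * (LINT \<xi>|lborel. LINT y|lborel. g y * (F \<xi> * k (\<xi> - y))))"
    by simp
  also have "(LINT \<xi>|lborel. LINT y|lborel. g y * (F \<xi> * k (\<xi> - y))) =
      (LINT y|lborel. g y * (LINT \<xi>|lborel. F \<xi> * k (\<xi> - y)))"
  proof (rule integral_kernel_swap[OF g])
    show "(\<lambda>(y, \<xi>). F \<xi> * k (\<xi> - y)) \<in> borel_measurable (lborel \<Otimes>\<^sub>M lborel)"
      unfolding case_prod_beta' by measurable
    show "(LINT \<xi>|lborel. norm (F \<xi> * k (\<xi> - y))) \<le> B * (LINT \<xi>|lborel. norm (k \<xi>))" for y
    proof -
      have "(LINT \<xi>|lborel. norm (F \<xi> * k (\<xi> - y))) \<le> (LINT \<xi>|lborel. B * norm (k (\<xi> - y)))"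
        by (rule integral_mono[OF integrable_norm[OF Fk] kB Fk_le])
      then show ?thesis using ck[of y] by simp
    qed
  qed (rule Fk)
  also have "?c * (LINT y|lborel. g y * (LINT \<xi>|lborel. F \<xi> * k (\<xi> - y))) =
      (LINT y|lborel. g y * (?c * (LINT \<xi>|lborel. F \<xi> * k (\<xi> - y))))"
    by (simp add: mult.left_commute)
  also have "\<dots> = (LINT y|lborel. g y * gauss_mean \<epsilon> F y)"
    unfolding k_def using F by (subst gauss_mean_eq[OF _ _ \<epsilon>]) auto
  finally show ?thesis unfolding F_def .
qed

lemma norm_inv_fourier_times_gauss_le:
  "norm (z * complex_of_real (gauss x)) \<le> norm z"
  by (simp add: norm_mult mult_left_le gauss_le_1)

text \<open>The composition is applied to \<open>g = fourier_multiplier n f\<close>, which is smooth and in \<open>L^p\<close> but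
  not Schwartz; multiplying it by \<open>gauss (\<epsilon> x)\<close> makes it Schwartz without increasing its norm.\<close>

lemma Lp_symbol_mult:
  fixes m n :: "'a::euclidean_space \<Rightarrow> complex"
  assumes p: "1 \<le> p" and m: "Lp_symbol p m" and n: "Lp_symbol p n"
  shows "Lp_symbol p (\<lambda>\<xi>. m \<xi> * n \<xi>)"
proof -
  obtain C D where C: "0 \<le> C" "\<And>f. schwartz f \<Longrightarrow> Lp_int p (fourier_multiplier m f) \<le> ennreal C * Lp_int p f"
    and D: "0 \<le> D" "\<And>f. schwartz f \<Longrightarrow> Lp_int p (fourier_multiplier n f) \<le> ennreal D * Lp_int p f"
    using Lp_symbolD(4)[OF m] Lp_symbolD(4)[OF n] by blast
  obtain A B where A: "\<And>\<xi>. norm (m \<xi>) \<le> A" and B: "\<And>\<xi>. norm (n \<xi>) \<le> B"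
    using Lp_symbolD(3)[OF m] Lp_symbolD(3)[OF n] by blast
  note [measurable] = Lp_symbolD(2)[OF m] Lp_symbolD(2)[OF n]
  let ?\<epsilon> = "\<lambda>k. inverse (real (Suc k))"
  have "Lp_int p (fourier_multiplier (\<lambda>\<xi>. m \<xi> * n \<xi>) f) \<le> ennreal (C * D) * Lp_int p f"
    if f: "schwartz f" for f
  \<comment> \<open>The bound for the damped functions does not depend on the damping, so it
    survives the pointwise limit.\<close>
  proof (rule Lp_int_Fatou)
    define g where "g \<xi> = n \<xi> * fourier f \<xi>" for \<xi>
    define u where "u k = (\<lambda>x. inv_fourier g x * complex_of_real (gauss (?\<epsilon> k *\<^sub>R x)))" for k
    have g: "rapid g" unfolding g_def
      by (rule rapid_symbol_times_fourier[OF Lp_symbolD(2,3)[OF n] f])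
    note gi = rapid_integrable[OF g]
    have [measurable]: "g \<in> borel_measurable borel" using g by (simp add: rapid_def)
    have u: "schwartz (u k)" for k
      unfolding u_def by (intro gauss_class_schwartz[of "?\<epsilon> k"] gauss_class.base g) simp
    show "fourier_multiplier m (u k) \<in> borel_measurable borel" for k
      by (rule fourier_multiplier_measurable[OF Lp_symbolD(2,3)[OF m] u])
    have "Lp_int p (u k) \<le> Lp_int p (inv_fourier g)" for k
      unfolding Lp_int_def u_def using p
      by (intro nn_integral_mono ennreal_leI powr_mono2 norm_inv_fourier_times_gauss_le) auto
    also have "Lp_int p (inv_fourier g) \<le> ennreal D * Lp_int p f"
      using D(2)[OF f] by (simp add: fourier_multiplier_def g_def[abs_def])
    finally have "ennreal C * Lp_int p (u k) \<le> ennreal C * (ennreal D * Lp_int p f)" for k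
      by (rule mult_left_mono) simp
    then show "Lp_int p (fourier_multiplier m (u k)) \<le> ennreal (C * D) * Lp_int p f" for k
      using order_trans[OF C(2)[OF u[of k]]] C(1) D(1) by (simp add: ennreal_mult' mult.assoc)
    show "0 < p" using p by simp
    fix x :: 'a
    define F where "F \<xi> = m \<xi> * exp (\<i> * complex_of_real (x \<bullet> \<xi>))" for \<xi>
    have [measurable]: "F \<in> borel_measurable borel" unfolding F_def by measurable
    have F: "norm (F \<xi>) \<le> A" for \<xi> using A by (simp add: F_def norm_mult)
    have contF: "continuous_on UNIV F"
      unfolding F_def by (intro continuous_intros Lp_symbolD(1)[OF m])
    \<comment> \<open>Continuity of the symbol gives pointwise convergence of the means, its bound
      \<open>A\<close> and the integrability of \<open>g\<close> the majorant.\<close>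
    have "(\<lambda>k. LINT y|lborel. g y * gauss_mean (?\<epsilon> k) F y) \<longlonglongrightarrow> (LINT y|lborel. g y * F y)"
    proof (rule integral_dominated_convergence[where w="\<lambda>y. A * norm (g y)"])
      show "integrable lborel (\<lambda>y. A * norm (g y))" using gi by simp
      show "(\<lambda>y. g y * gauss_mean (?\<epsilon> k) F y) \<in> borel_measurable lborel" for k
        unfolding gauss_mean_def by measurable
      show "AE y in lborel. (\<lambda>k. g y * gauss_mean (?\<epsilon> k) F y) \<longlonglongrightarrow> g y * F y"
        by (intro AE_I2 tendsto_mult tendsto_const gauss_mean_tendsto[OF contF F inverse_Suc_tendsto_0])
      show "AE y in lborel. norm (g y * gauss_mean (?\<epsilon> k) F y) \<le> A * norm (g y)" for k
      proof (rule AE_I2)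
        fix y
        have "norm (gauss_mean (?\<epsilon> k) F y) \<le> A" by (rule norm_gauss_mean_le) (auto simp: F)
        then show "norm (g y * gauss_mean (?\<epsilon> k) F y) \<le> A * norm (g y)"
          unfolding norm_mult mult.commute[of "norm (g y)"] by (rule mult_right_mono) simp
      qed
    qed measurable
    then have "(\<lambda>k. complex_of_real (1 / (2 * pi) ^ DIM('a)) * (LINT y|lborel. g y * gauss_mean (?\<epsilon> k) F y))
        \<longlonglongrightarrow> complex_of_real (1 / (2 * pi) ^ DIM('a)) * (LINT y|lborel. g y * F y)"
      by (intro tendsto_mult tendsto_const)
    moreover have "complex_of_real (1 / (2 * pi) ^ DIM('a)) * (LINT y|lborel. g y * F y) =
        fourier_multiplier (\<lambda>\<xi>. m \<xi> * n \<xi>) f x"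
      by (simp add: fourier_multiplier_def inv_fourier_def g_def F_def mult_ac)
    moreover have "fourier_multiplier m (u k) x =
        complex_of_real (1 / (2 * pi) ^ DIM('a)) * (LINT y|lborel. g y * gauss_mean (?\<epsilon> k) F y)" for k
      unfolding u_def F_def by (rule multiplier_times_gauss[OF gi _ _ A]) auto
    ultimately show "(\<lambda>k. fourier_multiplier m (u k) x) \<longlonglongrightarrow> fourier_multiplier (\<lambda>\<xi>. m \<xi> * n \<xi>) f x"
      by simp
  qed
  moreover have "norm (m \<xi> * n \<xi>) \<le> A * B" for \<xi>
    unfolding norm_mult using A B order_trans[OF norm_ge_zero A] by (intro mult_mono) auto
  ultimately have "\<exists>C::real. 0 \<le> C \<and> (\<forall>f. schwartz f \<longrightarrow>
      Lp_int p (fourier_multiplier (\<lambda>\<xi>. m \<xi> * n \<xi>) f) \<le> ennreal C * Lp_int p f)"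
    "\<exists>B. \<forall>\<xi>. norm (m \<xi> * n \<xi>) \<le> B"
    using C(1) D(1) by - (rule exI[of _ "C * D"], simp, rule exI[of _ "A * B"], blast)
  then show ?thesis
    unfolding Lp_symbol_def using Lp_symbolD(1)[OF m] Lp_symbolD(1)[OF n]
    by (auto intro: continuous_on_mult)
qed

section \<open>Symbols with integrable kernel\<close>

text \<open>Integrate the tangent line inequality for \<open>t powr p\<close> at the weighted mean of \<open>a\<close>.\<close>

lemma weighted_integral_powr_le:
  fixes w a :: "'a::euclidean_space \<Rightarrow> real"
  assumes w: "integrable lborel w" and w0: "\<And>x. 0 \<le> w x" and p: "1 \<le> p"
    and a [measurable]: "a \<in> borel_measurable borel" and a0: "\<And>x. 0 \<le> a x" and aB: "\<And>x. a x \<le> B"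
  shows "integrable lborel (\<lambda>x. w x * a x powr p)"
    and "(LINT x|lborel. w x * a x) powr p \<le>
      (LINT x|lborel. w x) powr (p - 1) * (LINT x|lborel. w x * a x powr p)"
proof -
  have [measurable]: "w \<in> borel_measurable borel" using borel_measurable_integrable[OF w] by simp
  have bdd: "integrable lborel (\<lambda>x. w x * h x)"
    if [measurable]: "h \<in> borel_measurable borel" and h0: "\<And>x. 0 \<le> h x" and hB: "\<And>x. h x \<le> K"
    for h :: "'a \<Rightarrow> real" and K
  proof (rule Bochner_Integration.integrable_bound)
    show "integrable lborel (\<lambda>x. w x * K)" using w by simp
    have "K \<ge> 0" using order_trans[OF h0 hB] .
    then show "AE x in lborel. norm (w x * h x) \<le> norm (w x * K)"
      using w0 h0 hB by (intro AE_I2) (simp add: abs_mult mult_left_mono)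
  qed measurable
  have int1: "integrable lborel (\<lambda>x. w x * a x)" by (rule bdd[OF a a0 aB])
  show int2: "integrable lborel (\<lambda>x. w x * a x powr p)"
    by (rule bdd[where K="B powr p"]) (use p a0 aB in \<open>auto intro: powr_mono2\<close>)
  define A I J where "A = (LINT x|lborel. w x)" and "I = (LINT x|lborel. w x * a x)"
    and "J = (LINT x|lborel. w x * a x powr p)"
  have A0: "A \<ge> 0" unfolding A_def using w0 by simp
  have I0: "I \<ge> 0" unfolding I_def using w0 a0 by simp
  have J0: "J \<ge> 0" unfolding J_def using w0 by simp
  show "I powr p \<le> A powr (p - 1) * J"
  proof (cases "I = 0")
    case True
    then show ?thesis using J0 p by simp
  next
    case False
    with I0 have I: "I > 0" by simp
    have "I \<le> B * A"
    proof -
      have "I \<le> (LINT x|lborel. B * w x)"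
        unfolding I_def
        by (rule integral_mono[OF int1]) (use w w0 aB in \<open>auto simp: mult.commute intro: mult_right_mono\<close>)
      then show ?thesis by (simp add: A_def)
    qed
    with I A0 have A: "A > 0" by (cases "A = 0") auto
    define M where "M = I / A"
    have M: "M > 0" using I A by (simp add: M_def)
    \<comment> \<open>Young's inequality with weights 1 / p and 1 - 1 / p for the p-th powers of
      \<open>a x\<close> and \<open>M\<close>: this is the tangent line at \<open>M\<close>, divided
      by p and multiplied by \<open>w x\<close>.\<close>
    have tangent: "w x * a x * M powr (p - 1) \<le> (1 / p) * (w x * a x powr p) + (1 - 1 / p) * M powr p * w x" for x
    proof -
      have "a x * M powr (p - 1) \<le> (1 / p) * a x powr p + (1 - 1 / p) * M powr p"
      proof (cases "a x = 0")
        case False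
        then have "a x > 0" using a0[of x] by simp
        then have "(a x powr p) powr (1 / p) * (M powr p) powr (1 - 1 / p) \<le>
            (1 / p) * a x powr p + (1 - 1 / p) * M powr p"
          using p M by (intro Youngs_inequality_0) auto
        moreover have "p * (1 - 1 / p) = p - 1" using p by (simp add: field_simps)
        ultimately show ?thesis
          using p \<open>a x > 0\<close> M by (simp only: powr_powr) simp
      qed (use p in simp)
      from mult_left_mono[OF this w0[of x]] show ?thesis by (simp only: distrib_left mult_ac)
    qed
    have "I * M powr (p - 1) = (LINT x|lborel. w x * a x * M powr (p - 1))"
      by (simp add: I_def)
    also have "\<dots> \<le> (LINT x|lborel. (1 / p) * (w x * a x powr p) + (1 - 1 / p) * M powr p * w x)"
      by (intro integral_mono tangent) (use int1 int2 w in auto)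
    also have "\<dots> = (1 / p) * J + (1 - 1 / p) * M powr p * A"
      using int2 w by (simp add: J_def A_def)
    finally have 1: "I * M powr (p - 1) \<le> (1 / p) * J + (1 - 1 / p) * M powr p * A" .
    have Mp: "M powr p = M * M powr (p - 1)" using M powr_add[of M 1 "p - 1"] by simp
    have "I * M powr (p - 1) = A * M powr p"
      unfolding Mp using A by (simp add: M_def)
    with 1 have "A * M powr p \<le> J" using p by (simp add: field_simps)
    then have "A powr (p - 1) * (A * M powr p) \<le> A powr (p - 1) * J"
      by (rule mult_left_mono) simp
    also have "A powr (p - 1) * (A * M powr p) = (A * M) powr p"
      using A M powr_add[of A "p - 1" 1] by (simp add: powr_mult)
    also have "A * M = I" using A by (simp add: M_def)
    finally show ?thesis .
  qed
qed

lemma nn_integral_lborel_translate: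
  fixes f :: "'a::euclidean_space \<Rightarrow> ennreal"
  assumes [measurable]: "f \<in> borel_measurable borel"
  shows "(\<integral>\<^sup>+ x. f (t + x) \<partial>lborel) = (\<integral>\<^sup>+ x. f x \<partial>lborel)"
  by (subst (2) lborel_distr_plus[of t, symmetric]) (simp add: nn_integral_distr)

text \<open>The multiplier is an integral against translates of \<open>fourier m\<close>, hence
  dominated by averages with an integrable weight. The weighted power inequality at each point, then
  Tonelli and translation invariance, prove Young's inequality for an L^1 kernel, for all p \<ge> 1
  alike.\<close>

lemma Lp_symbol_kernel:
  fixes m :: "'a::euclidean_space \<Rightarrow> complex"
  assumes p: "1 \<le> p" and cont: "continuous_on UNIV m" and B: "\<And>\<xi>. norm (m \<xi>) \<le> B"
    and int: "integrable lborel m" and C: "0 \<le> C" "\<And>\<xi>. norm (fourier m \<xi>) \<le> C * decay_weight \<xi>"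
  shows "Lp_symbol p m"
proof -
  define c where "c = 1 / (2 * pi) ^ DIM('a)"
  have c: "c \<ge> 0" by (simp add: c_def)
  let ?W = "decay_weight :: 'a \<Rightarrow> real"
  define A where "A = (LINT u|lborel. ?W u)"
  have A: "A \<ge> 0" unfolding A_def by (simp add: decay_weight_nonneg)
  have [measurable]: "?W \<in> borel_measurable borel"
    using borel_measurable_integrable[OF integrable_decay_weight] by simp
  have [measurable]: "fourier m \<in> borel_measurable borel"
    by (intro borel_measurable_continuous_onI continuous_on_fourier int)
  \<comment> \<open>The factor \<open>A powr (p - 1)\<close> comes from the power inequality, and
    Tonelli contributes one more \<open>A\<close>: the final constant \<open>K * A\<close> is the
    p-th power of \<open>c * C * A\<close>.\<close>
  define K where "K = (c * C) powr p * A powr (p - 1)"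
  have K: "K \<ge> 0" by (simp add: K_def)
  have "Lp_int p (fourier_multiplier m f) \<le> ennreal (K * A) * Lp_int p f" if f: "schwartz f" for f
  proof -
    note r = schwartz_rapid[OF f]
    note fi = rapid_integrable[OF r]
    have [measurable]: "f \<in> borel_measurable borel" using r by (simp add: rapid_def)
    obtain D where D: "\<And>x. norm (f x) \<le> D" using rapid_bounded[OF r] by blast
    have bound: "ennreal (norm (fourier_multiplier m f x) powr p) \<le>
        ennreal K * (\<integral>\<^sup>+ u. ennreal (?W u * norm (f (x + u)) powr p) \<partial>lborel)" for x
    proof -
      have W: "integrable lborel (\<lambda>u. ?W u * norm (f (x + u)) powr p)"
        "(LINT u|lborel. ?W u * norm (f (x + u))) powr p \<le> A powr (p - 1) * (LINT u|lborel. ?W u * norm (f (x + u)) powr p)"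
        unfolding A_def
        by (rule weighted_integral_powr_le[where B=D]; simp add: p decay_weight_nonneg integrable_decay_weight D)+
      have W1: "integrable lborel (\<lambda>u. ?W u * norm (f (x + u)))"
        using weighted_integral_powr_le(1)[where B=D and p=1 and w="?W" and a="\<lambda>u. norm (f (x + u))"] D
        by (simp add: decay_weight_nonneg integrable_decay_weight)
      have fm: "integrable lborel (\<lambda>y. f y * fourier m (y - x))"
      proof (rule Bochner_Integration.integrable_bound)
        show "integrable lborel (\<lambda>y. (LINT x|lborel. norm (m x)) * norm (f y))" using fi by simp
        have "norm (f y * fourier m (y - x)) \<le> (LINT x|lborel. norm (m x)) * norm (f y)" for y
          unfolding norm_mult mult.commute[of "norm (f y)"]
          by (intro mult_right_mono norm_fourier_le int) simp
        then show "AE y in lborel. norm (f y * fourier m (y - x)) \<le> norm ((LINT x|lborel. norm (m x)) * norm (f y))"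
          by (intro AE_I2) (simp add: abs_mult)
      qed measurable
      have "fourier_multiplier m f x = complex_of_real c * (LINT \<xi>|lborel. fourier f \<xi> * (m \<xi> * exp (\<i> * complex_of_real (x \<bullet> \<xi>))))"
        by (simp add: fourier_multiplier_def inv_fourier_def c_def mult_ac)
      also have "(LINT \<xi>|lborel. fourier f \<xi> * (m \<xi> * exp (\<i> * complex_of_real (x \<bullet> \<xi>)))) =
          (LINT y|lborel. f y * fourier m (y - x))"
        unfolding fourier_modulate[symmetric]
        by (intro fourier_multiplication_formula fi integrable_inv_fourier_integrand int)
      also have "\<dots> = (LINT u|lborel. f (x + u) * fourier m u)"
        using integral_lborel_affine[OF _ fm, of 1 x] by simp
      finally have "norm (fourier_multiplier m f x) = c * norm (LINT u|lborel. f (x + u) * fourier m u)"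
        using c by (simp add: norm_mult)
      also have "\<dots> \<le> c * (LINT u|lborel. C * (?W u * norm (f (x + u))))"
      proof (rule mult_left_mono[OF _ c], rule Bochner_Integration.integral_norm_bound_integral)
        show "integrable lborel (\<lambda>u. f (x + u) * fourier m u)"
          using integrable_lborel_affine[OF _ fm, of 1 x] by simp
        show "integrable lborel (\<lambda>u. C * (?W u * norm (f (x + u))))" using W1 by simp
        fix u
        have "norm (f (x + u) * fourier m u) \<le> norm (f (x + u)) * (C * ?W u)"
          unfolding norm_mult by (intro mult_left_mono C) simp
        then show "norm (f (x + u) * fourier m u) \<le> C * (?W u * norm (f (x + u)))"
          by (simp only: mult_ac)
      qed
      also have "\<dots> = c * C * (LINT u|lborel. ?W u * norm (f (x + u)))" by simp
      finally have "norm (fourier_multiplier m f x) powr p \<le> (c * C * (LINT u|lborel. ?W u * norm (f (x + u)))) powr p"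
        using p by (intro powr_mono2) auto
      also have "\<dots> = (c * C) powr p * (LINT u|lborel. ?W u * norm (f (x + u))) powr p"
        by (rule powr_mult)
      also have "\<dots> \<le> (c * C) powr p * (A powr (p - 1) * (LINT u|lborel. ?W u * norm (f (x + u)) powr p))"
        using W(2) by (rule mult_left_mono) simp
      also have "\<dots> = K * (LINT u|lborel. ?W u * norm (f (x + u)) powr p)"
        by (simp add: K_def)
      finally have "ennreal (norm (fourier_multiplier m f x) powr p) \<le>
          ennreal (K * (LINT u|lborel. ?W u * norm (f (x + u)) powr p))"
        by (rule ennreal_leI)
      also have "\<dots> = ennreal K * (\<integral>\<^sup>+ u. ennreal (?W u * norm (f (x + u)) powr p) \<partial>lborel)"
        using W(1) K by (subst nn_integral_eq_integral) (auto simp: decay_weight_nonneg ennreal_mult')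
      finally show ?thesis .
    qed
    have "Lp_int p (fourier_multiplier m f) \<le>
        (\<integral>\<^sup>+ x. ennreal K * (\<integral>\<^sup>+ u. ennreal (?W u * norm (f (x + u)) powr p) \<partial>lborel) \<partial>lborel)"
      unfolding Lp_int_def by (intro nn_integral_mono bound)
    also have "\<dots> = ennreal K * (\<integral>\<^sup>+ x. \<integral>\<^sup>+ u. ennreal (?W u * norm (f (x + u)) powr p) \<partial>lborel \<partial>lborel)"
      by (rule nn_integral_cmult) measurable
    also have "(\<integral>\<^sup>+ x. \<integral>\<^sup>+ u. ennreal (?W u * norm (f (x + u)) powr p) \<partial>lborel \<partial>lborel) =
        (\<integral>\<^sup>+ u. \<integral>\<^sup>+ x. ennreal (?W u * norm (f (x + u)) powr p) \<partial>lborel \<partial>lborel)"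
      by (rule lborel_pair.Fubini') measurable
    also have "\<dots> = (\<integral>\<^sup>+ u. ennreal (?W u) * Lp_int p f \<partial>lborel)"
    proof (rule nn_integral_cong)
      fix u :: 'a
      have "(\<integral>\<^sup>+ x. ennreal (?W u * norm (f (x + u)) powr p) \<partial>lborel) =
          ennreal (?W u) * (\<integral>\<^sup>+ x. ennreal (norm (f (u + x)) powr p) \<partial>lborel)"
        by (subst nn_integral_cmult[symmetric]) (auto simp: ennreal_mult' decay_weight_nonneg add.commute)
      also have "(\<integral>\<^sup>+ x. ennreal (norm (f (u + x)) powr p) \<partial>lborel) = Lp_int p f"
        unfolding Lp_int_def by (rule nn_integral_lborel_translate) measurable
      finally show "(\<integral>\<^sup>+ x. ennreal (?W u * norm (f (x + u)) powr p) \<partial>lborel) = ennreal (?W u) * Lp_int p f" .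
    qed
    also have "\<dots> = ennreal A * Lp_int p f"
      by (subst nn_integral_multc)
         (auto simp: A_def nn_integral_eq_integral integrable_decay_weight decay_weight_nonneg)
    also have "ennreal K * (ennreal A * Lp_int p f) = ennreal (K * A) * Lp_int p f"
      using K A by (simp add: ennreal_mult' mult.assoc)
    finally show ?thesis .
  qed
  then have "\<exists>C::real. 0 \<le> C \<and> (\<forall>f. schwartz f \<longrightarrow> Lp_int p (fourier_multiplier m f) \<le> ennreal C * Lp_int p f)"
    using K A by (intro exI[of _ "K * A"]) auto
  then show ?thesis unfolding Lp_symbol_def using cont B by blast
qed

section \<open>Powers of the Bochner-Riesz symbol\<close>

text \<open>Unlike \<open>cont_integrable\<close>, this class is stable under multiplication by
  continuous functions such as the linear factors that differentiation produces.\<close>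

definition compact_cont :: "('a::euclidean_space \<Rightarrow> complex) \<Rightarrow> bool" where
  "compact_cont h \<longleftrightarrow> continuous_on UNIV h \<and> (\<forall>\<xi>. 1 < norm \<xi> \<longrightarrow> h \<xi> = 0)"

lemma compact_cont_add: "compact_cont f \<Longrightarrow> compact_cont g \<Longrightarrow> compact_cont (\<lambda>\<xi>. f \<xi> + g \<xi>)"
  by (auto simp: compact_cont_def intro: continuous_on_add)

lemma compact_cont_times: "continuous_on UNIV g \<Longrightarrow> compact_cont f \<Longrightarrow> compact_cont (\<lambda>\<xi>. g \<xi> * f \<xi>)"
  by (auto simp: compact_cont_def intro: continuous_on_mult)

lemma compact_cont_integrable:
  assumes "compact_cont h"
  shows "cont_integrable h"
proof -
  have "integrable lborel (\<lambda>\<xi>. indicator (cball 0 1) \<xi> *\<^sub>R h \<xi>)"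
    using assms by (intro borel_integrable_compact) (auto simp: compact_cont_def intro: continuous_on_subset)
  also have "(\<lambda>\<xi>. indicator (cball 0 1) \<xi> *\<^sub>R h \<xi>) = h"
    using assms by (auto simp: fun_eq_iff compact_cont_def indicator_def)
  finally show ?thesis using assms by (simp add: cont_integrable_def compact_cont_def)
qed

lemma compact_cont_bounded:
  assumes "compact_cont h"
  obtains B where "\<And>\<xi>. norm (h \<xi>) \<le> B"
proof -
  have "bounded (h ` cball 0 1)"
    using assms unfolding compact_cont_def
    by (intro compact_imp_bounded compact_continuous_image) (auto intro: continuous_on_subset)
  then obtain B where B: "\<And>\<xi>. \<xi> \<in> cball 0 1 \<Longrightarrow> norm (h \<xi>) \<le> B"
    unfolding bounded_iff by blast
  have "norm (h \<xi>) \<le> max B 0" for \<xi>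
    using assms B[of \<xi>] by (cases "\<xi> \<in> cball 0 1") (auto simp: compact_cont_def)
  then show ?thesis by (rule that)
qed

lemma dir_smooth_SucI:
  assumes "P f" "\<And>x. ((\<lambda>t. f (x + t *\<^sub>R b)) has_vector_derivative f' x) (at 0)" "dir_smooth P b k f'"
  shows "dir_smooth P b (Suc k) f"
  using assms by auto

lemma dir_smooth_add:
  assumes "dir_smooth compact_cont b k f" "dir_smooth compact_cont b k g"
  shows "dir_smooth compact_cont b k (\<lambda>\<xi>. f \<xi> + g \<xi>)"
  using assms
proof (induction k arbitrary: f g)
  case (Suc k)
  from Suc.prems obtain f' g' where
    f': "\<And>x. ((\<lambda>t. f (x + t *\<^sub>R b)) has_vector_derivative f' x) (at 0)" "dir_smooth compact_cont b k f'" and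
    g': "\<And>x. ((\<lambda>t. g (x + t *\<^sub>R b)) has_vector_derivative g' x) (at 0)" "dir_smooth compact_cont b k g'"
    by auto
  have "((\<lambda>t. f (x + t *\<^sub>R b) + g (x + t *\<^sub>R b)) has_vector_derivative f' x + g' x) (at 0)" for x
    by (intro has_vector_derivative_add f' g')
  moreover have "dir_smooth compact_cont b k (\<lambda>x. f' x + g' x)"
    by (intro Suc.IH f' g')
  moreover have "compact_cont (\<lambda>\<xi>. f \<xi> + g \<xi>)"
    using Suc.prems by (intro compact_cont_add) auto
  ultimately show ?case by (intro dir_smooth_SucI)
qed (simp add: compact_cont_add)

lemma dir_smooth_cmult:
  assumes "dir_smooth compact_cont b k f"
  shows "dir_smooth compact_cont b k (\<lambda>\<xi>. c * f \<xi>)"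
  using assms
proof (induction k arbitrary: f)
  case (Suc k)
  from Suc.prems obtain f' where
    f': "\<And>x. ((\<lambda>t. f (x + t *\<^sub>R b)) has_vector_derivative f' x) (at 0)" "dir_smooth compact_cont b k f'"
    by auto
  have "((\<lambda>t. c * f (x + t *\<^sub>R b)) has_vector_derivative c * f' x) (at 0)" for x
    by (intro has_vector_derivative_mult_right f')
  moreover have "dir_smooth compact_cont b k (\<lambda>x. c * f' x)"
    by (intro Suc.IH f')
  moreover have "compact_cont (\<lambda>\<xi>. c * f \<xi>)"
    using Suc.prems by (intro compact_cont_times continuous_on_const) auto
  ultimately show ?case by (intro dir_smooth_SucI)
qed (auto intro: compact_cont_times continuous_on_const)

text \<open>The product rule leaves \<open>f\<close> itself beside \<open>f'\<close>, so the
  induction also uses \<open>f\<close> one level lower. The linear factor is the one from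
  differentiating \<open>(norm \<xi>)\<^sup>2\<close> along \<open>b\<close>.\<close>

lemma dir_smooth_inner:
  assumes "dir_smooth compact_cont b k f"
  shows "dir_smooth compact_cont b k (\<lambda>\<xi>. complex_of_real (\<xi> \<bullet> b) * f \<xi>)"
  using assms
proof (induction k arbitrary: f)
  case 0
  then show ?case by (auto intro!: compact_cont_times continuous_intros)
next
  case (Suc k)
  from Suc.prems obtain f' where f: "compact_cont f" and
    f': "\<And>x. ((\<lambda>t. f (x + t *\<^sub>R b)) has_vector_derivative f' x) (at 0)" "dir_smooth compact_cont b k f'"
    by auto
  have "((\<lambda>t. complex_of_real ((x + t *\<^sub>R b) \<bullet> b) * f (x + t *\<^sub>R b)) has_vector_derivative
      complex_of_real (x \<bullet> b) * f' x + complex_of_real (b \<bullet> b) * f x) (at 0)" for x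
  proof -
    have "((\<lambda>t. (x + t *\<^sub>R b) \<bullet> b) has_real_derivative b \<bullet> b) (at 0)"
      by (auto intro!: derivative_eq_intros simp: inner_add_left)
    then have "((\<lambda>t. complex_of_real ((x + t *\<^sub>R b) \<bullet> b)) has_vector_derivative complex_of_real (b \<bullet> b)) (at 0)"
      by (intro has_vector_derivative_of_real) (simp add: has_real_derivative_iff_has_vector_derivative)
    from has_vector_derivative_mult[OF this f'(1)[of x]] show ?thesis by (simp add: algebra_simps)
  qed
  moreover have "dir_smooth compact_cont b k (\<lambda>x. complex_of_real (x \<bullet> b) * f' x + complex_of_real (b \<bullet> b) * f x)"
    using dir_smooth_Suc_lower[OF Suc.prems] f'(2) by (intro dir_smooth_add dir_smooth_cmult Suc.IH)
  moreover have "compact_cont (\<lambda>\<xi>. complex_of_real (\<xi> \<bullet> b) * f \<xi>)"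
    by (intro compact_cont_times f) (auto intro!: continuous_intros)
  ultimately show ?case by (intro dir_smooth_SucI)
qed

text \<open>The radial form of m^n r^j, to be read at v = 1 - |\<xi>|^2 with s = n \<delta>. The
  exponents are independent parameters because differentiation leads to the pairs (s - 1, j) and (s
  - 1 + \<delta>, j + 1).\<close>

definition profile :: "real \<Rightarrow> complex \<Rightarrow> real \<Rightarrow> nat \<Rightarrow> real \<Rightarrow> complex" where
  "profile \<delta> z s j v = complex_of_real (max v 0 powr s) * inverse (z - complex_of_real (max v 0 powr \<delta>)) ^ j"

lemma resolvent_denominator_nonzero:
  assumes "z \<notin> complex_of_real ` {0..1}" "0 < \<delta>" "v \<le> 1"
  shows "z - complex_of_real (max v 0 powr \<delta>) \<noteq> 0"
proof -
  have "max v 0 powr \<delta> \<le> 1 powr \<delta>" using assms by (intro powr_mono2) auto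
  then have "max v 0 powr \<delta> \<in> {0..1}" by simp
  with assms(1) show ?thesis by auto
qed

lemma continuous_on_profile:
  assumes z: "z \<notin> complex_of_real ` {0..1}" and \<delta>: "0 < \<delta>" and s: "0 < s"
  shows "continuous_on {..1} (profile \<delta> z s j)"
proof -
  have "continuous_on {..1} (\<lambda>v::real. max v 0 powr r)" if "r > 0" for r :: real
    using that by (intro continuous_on_powr' continuous_intros) auto
  note this[OF \<delta>] this[OF s]
  then show ?thesis unfolding profile_def[abs_def]
    using resolvent_denominator_nonzero[OF z \<delta>]
    by (intro continuous_on_mult continuous_on_power continuous_on_inverse continuous_on_diff
        continuous_on_of_real continuous_on_const) auto
qed

text \<open>At \<open>v = 0\<close> this uses \<open>profile \<delta> z s j v = v * profile \<delta> z (s - 1) j v\<close>.\<close>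

lemma profile_has_vector_derivative:
  assumes z: "z \<notin> complex_of_real ` {0..1}" and \<delta>: "0 < \<delta>" and s: "1 < s" and v: "v \<le> 1"
  shows "(profile \<delta> z s j has_vector_derivative
     complex_of_real s * profile \<delta> z (s - 1) j v +
     of_nat j * complex_of_real \<delta> * profile \<delta> z (s - 1 + \<delta>) (Suc j) v) (at v)"
proof -
  consider "v > 0" | "v < 0" | "v = 0" by linarith
  then show ?thesis
  proof cases
    case 1
    have nz: "z - complex_of_real (v powr \<delta>) \<noteq> 0"
      using resolvent_denominator_nonzero[OF z \<delta> v] 1 by (simp add: max_def)
    have pow: "((\<lambda>v. complex_of_real (v powr r)) has_vector_derivative complex_of_real (r * v powr (r - 1))) (at v)" for r
      using has_real_derivative_powr[OF 1, of r]
      by (intro has_vector_derivative_of_real) (simp add: has_real_derivative_iff_has_vector_derivative)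
    let ?I = "inverse (z - complex_of_real (v powr \<delta>))"
    \<comment> \<open>The chain rule is split at the complex variable w = v^\<delta>; the sign is
      positive since w enters with a minus inside the inverse.\<close>
    have "((\<lambda>w. inverse (z - w) ^ j) has_field_derivative of_nat j * ?I ^ Suc j) (at (complex_of_real (v powr \<delta>)))"
    proof -
      have "((\<lambda>w. inverse (z - w)) has_field_derivative ?I * ?I) (at (complex_of_real (v powr \<delta>)))"
        using nz by (auto intro!: derivative_eq_intros)
      from DERIV_power[OF this, of j] show ?thesis
        by (cases j) (simp_all add: mult.assoc)
    qed
    from field_vector_diff_chain_at[OF pow this]
    have "((\<lambda>v. inverse (z - complex_of_real (v powr \<delta>)) ^ j) has_vector_derivative
        complex_of_real (\<delta> * v powr (\<delta> - 1)) * (of_nat j * ?I ^ Suc j)) (at v)"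
      by (simp add: o_def)
    from has_vector_derivative_mult[OF pow[of s] this]
    have D: "((\<lambda>v. complex_of_real (v powr s) * inverse (z - complex_of_real (v powr \<delta>)) ^ j) has_vector_derivative
        complex_of_real (v powr s) * (complex_of_real (\<delta> * v powr (\<delta> - 1)) * (of_nat j * ?I ^ Suc j)) +
        complex_of_real (s * v powr (s - 1)) * ?I ^ j) (at v)" .
    have "v powr s * v powr (\<delta> - 1) = v powr (s - 1 + \<delta>)"
      by (simp add: powr_add[symmetric] algebra_simps)
    then have "complex_of_real (v powr s) * complex_of_real (v powr (\<delta> - 1)) = complex_of_real (v powr (s - 1 + \<delta>))"
      by (simp only: of_real_mult[symmetric])
    then have eq: "complex_of_real (v powr s) * (complex_of_real (\<delta> * v powr (\<delta> - 1)) * (of_nat j * ?I ^ Suc j)) +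
        complex_of_real (s * v powr (s - 1)) * ?I ^ j =
        complex_of_real s * profile \<delta> z (s - 1) j v +
        of_nat j * complex_of_real \<delta> * profile \<delta> z (s - 1 + \<delta>) (Suc j) v"
      using 1 by (simp add: profile_def max_def mult_ac)
    show ?thesis
      by (rule has_vector_derivative_transform_within_open[OF D[unfolded eq], where S="{0<..}"])
        (use 1 in \<open>auto simp: profile_def max_def\<close>)
  next
    case 2
    have "((\<lambda>_. 0) has_vector_derivative (0::complex)) (at v)" by (rule has_vector_derivative_const)
    then have "(profile \<delta> z s j has_vector_derivative 0) (at v)"
      by (rule has_vector_derivative_transform_within_open[where S="{..<0}"]) (use 2 in \<open>auto simp: profile_def max_def\<close>)
    then show ?thesis using 2 by (simp add: profile_def max_def)
  next
    case 3
    have "continuous_on {..<1} (profile \<delta> z (s - 1) j)"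
      using s by (intro continuous_on_subset[OF continuous_on_profile[OF z \<delta>]]) auto
    then have "isCont (profile \<delta> z (s - 1) j) 0"
      by (rule continuous_on_interior) (simp add: interior_open)
    moreover have "profile \<delta> z (s - 1) j 0 = 0" by (simp add: profile_def)
    ultimately have lim: "((\<lambda>v. norm (profile \<delta> z (s - 1) j v)) \<longlongrightarrow> 0) (at 0)"
      by (intro tendsto_norm_zero) (simp add: isCont_def)
    have fac: "profile \<delta> z s j y = y *\<^sub>R profile \<delta> z (s - 1) j y" for y
    proof (cases "y > 0")
      case True
      then have "y powr s = y * y powr (s - 1)" using powr_add[of y 1 "s - 1"] by simp
      then show ?thesis using True by (simp add: profile_def max_def scaleR_conv_of_real)
    qed (auto simp: profile_def max_def)
    have "(profile \<delta> z s j has_derivative (\<lambda>h. h *\<^sub>R 0)) (at 0)"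
      by (rule has_derivativeI_sandwich[where e=1, OF _ _ _ lim]) (auto simp: fac)
    then show ?thesis using 3 by (simp add: has_vector_derivative_def profile_def)
  qed
qed

definition BR_power :: "real \<Rightarrow> complex \<Rightarrow> real \<Rightarrow> nat \<Rightarrow> 'a::euclidean_space \<Rightarrow> complex" where
  "BR_power \<delta> z s j \<xi> = profile \<delta> z s j (1 - (norm \<xi>)\<^sup>2)"

lemma compact_cont_BR_power:
  assumes z: "z \<notin> complex_of_real ` {0..1}" and \<delta>: "0 < \<delta>" and s: "0 < s"
  shows "compact_cont (BR_power \<delta> z s j)"
  unfolding compact_cont_def
proof (intro conjI allI impI)
  show "continuous_on UNIV (BR_power \<delta> z s j)"
    unfolding BR_power_def[abs_def]
    by (rule continuous_on_compose2[OF continuous_on_profile[OF assms]]) (auto intro!: continuous_intros)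
  fix \<xi> :: 'a assume "1 < norm \<xi>"
  then have "1 - (norm \<xi>)\<^sup>2 < 0" using one_less_power[of "norm \<xi>" 2] by simp
  then show "BR_power \<delta> z s j \<xi> = 0" by (simp add: BR_power_def profile_def max_def)
qed

text \<open>A derivative stays within the family, up to linear factors, and costs at most 1 in the
  exponent. So s > k leaves a positive exponent, hence continuity across the sphere, after k
  derivatives, whatever j has become.\<close>

lemma dir_smooth_BR_power:
  assumes z: "z \<notin> complex_of_real ` {0..1}" and \<delta>: "0 < \<delta>" and s: "real k < s"
  shows "dir_smooth compact_cont b k (BR_power \<delta> z s j)"
  using s
proof (induction k arbitrary: s j)
  case 0
  then show ?case using compact_cont_BR_power[OF z \<delta>] by simp
next
  case (Suc k)
  let ?h = "\<lambda>\<xi>. complex_of_real s * BR_power \<delta> z (s - 1) j \<xi> +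
     of_nat j * complex_of_real \<delta> * BR_power \<delta> z (s - 1 + \<delta>) (Suc j) \<xi>"
  have "((\<lambda>t. BR_power \<delta> z s j (x + t *\<^sub>R b)) has_vector_derivative
      (- 2) * (complex_of_real (x \<bullet> b) * ?h x)) (at 0)" for x
  proof -
    have eq: "(norm (x + t *\<^sub>R b))\<^sup>2 = (x + t *\<^sub>R b) \<bullet> (x + t *\<^sub>R b)" for t
      by (rule power2_norm_eq_inner)
    have "((\<lambda>t. 1 - (norm (x + t *\<^sub>R b))\<^sup>2) has_vector_derivative - 2 * (x \<bullet> b)) (at 0)"
      unfolding eq has_real_derivative_iff_has_vector_derivative[symmetric]
      by (auto intro!: derivative_eq_intros simp: inner_add_left inner_add_right inner_commute)
    moreover have "(profile \<delta> z s j has_vector_derivative ?h x) (at (1 - (norm (x + 0 *\<^sub>R b))\<^sup>2))"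
      unfolding BR_power_def using Suc.prems profile_has_vector_derivative[OF z \<delta>, of s "1 - (norm x)\<^sup>2" j] by simp
    ultimately have "(profile \<delta> z s j \<circ> (\<lambda>t. 1 - (norm (x + t *\<^sub>R b))\<^sup>2) has_vector_derivative
        (- 2 * (x \<bullet> b)) *\<^sub>R ?h x) (at 0)"
      by (rule vector_diff_chain_at)
    then show ?thesis by (simp add: BR_power_def[abs_def] o_def scaleR_conv_of_real mult.assoc)
  qed
  moreover have "dir_smooth compact_cont b k (\<lambda>x. (- 2) * (complex_of_real (x \<bullet> b) * ?h x))"
    using Suc.prems \<delta> by (intro dir_smooth_cmult dir_smooth_inner dir_smooth_add Suc.IH) auto
  moreover have "compact_cont (BR_power \<delta> z s j :: 'a \<Rightarrow> complex)"
    using Suc.prems by (intro compact_cont_BR_power z \<delta>) auto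
  ultimately show ?case by (intro dir_smooth_SucI)
qed

lemma Lp_symbol_BR_power:
  assumes p: "1 \<le> p" and z: "z \<notin> complex_of_real ` {0..1}" and \<delta>: "0 < \<delta>" and s: "real (2 * DIM('a)) < s"
  shows "Lp_symbol p (BR_power \<delta> z s j :: 'a::euclidean_space \<Rightarrow> complex)"
proof -
  have cc: "compact_cont (BR_power \<delta> z s j :: 'a \<Rightarrow> complex)"
    using s by (intro compact_cont_BR_power z \<delta>) auto
  obtain B where B: "\<And>\<xi>::'a. norm (BR_power \<delta> z s j \<xi>) \<le> B"
    using compact_cont_bounded[OF cc] by blast
  have "dir_smooth cont_integrable b (2 * DIM('a)) (BR_power \<delta> z s j)" for b :: 'a
    using dir_smooth_BR_power[OF z \<delta> s] by (rule dir_smooth_mono) (rule compact_cont_integrable)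
  then obtain C where "C \<ge> 0" "\<And>\<xi>::'a. norm (fourier (BR_power \<delta> z s j) \<xi>) \<le> C * decay_weight \<xi>"
    using fourier_decay_weight by blast
  with compact_cont_integrable[OF cc] B show ?thesis
    by (intro Lp_symbol_kernel[OF p]) (auto simp: cont_integrable_def)
qed

lemma Lp_symbol_power:
  assumes p: "1 \<le> p" and m: "Lp_symbol p m"
  shows "Lp_symbol p (\<lambda>\<xi>. m \<xi> ^ k)"
proof (induction k)
  case 0
  then show ?case using Lp_symbol_const[OF p, of 1] by simp
next
  case (Suc k)
  from Lp_symbol_mult[OF p m this] show ?case by simp
qed

lemma Lp_symbol_cmult:
  assumes "1 \<le> p" "Lp_symbol p m"
  shows "Lp_symbol p (\<lambda>\<xi>. a * m \<xi>)"
  using Lp_symbol_mult[OF assms(1) Lp_symbol_const[OF assms(1)] assms(2)] .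

text \<open>The case n = 0 must be excluded: since \<open>0 powr 0 = 0\<close>, the right-hand side
  would vanish outside the ball while the left-hand side does not.\<close>

lemma BR_symbol_power_times_resolvent:
  fixes \<xi> :: "'a::euclidean_space"
  assumes "n \<noteq> 0"
  shows "BR_symbol \<delta> \<xi> ^ n * inverse (z - BR_symbol \<delta> \<xi>) ^ j = BR_power \<delta> z (real n * \<delta>) j \<xi>"
proof -
  have "(u powr \<delta>) ^ n = u powr (real n * \<delta>)" if "0 \<le> u" for u :: real
    using that assms by (cases "u = 0") (simp_all add: powr_power mult.commute)
  then show ?thesis
    by (simp add: BR_symbol_def BR_power_def profile_def flip: of_real_power)
qed

lemma Lp_symbol_iff_bounded_on_Lp:
  assumes "1 \<le> p" "continuous_on UNIV m" "\<And>\<xi>. norm (m \<xi>) \<le> B"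
  shows "Lp_symbol p m \<longleftrightarrow> bounded_on_Lp p (fourier_multiplier m)"
  using assms unfolding Lp_symbol_def bounded_on_Lp_iff[OF assms(1)] by blast

section \<open>The descending inductions at a fixed resolvent point\<close>

context
  fixes \<delta> p :: real and z :: complex
  assumes \<delta>: "\<delta> > 0" and p: "1 \<le> p" and z: "z \<notin> complex_of_real ` {0..1}"
begin

lemma resolvent_point_nonzero: "z \<noteq> 0"
proof
  assume "z = 0"
  then have "z = complex_of_real 0" by simp
  with z show False by (metis atLeastAtMost_iff imageI order_refl zero_le_one)
qed

lemma BR_symbol_neq: "z \<noteq> BR_symbol \<delta> \<xi>"
  using resolvent_denominator_nonzero[OF z \<delta>, of "1 - (norm \<xi>)\<^sup>2"] by (simp add: BR_symbol_def)

lemma BR_symbol_resolvent: "inverse (z - BR_symbol \<delta> \<xi>) * (z - BR_symbol \<delta> \<xi>) = 1"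
  using BR_symbol_neq[of \<xi>] by simp

lemma Lp_symbol_BR_symbol_iff:
  "Lp_symbol p (BR_symbol \<delta> :: 'a::euclidean_space \<Rightarrow> complex) \<longleftrightarrow>
   bounded_on_Lp p (bochner_riesz \<delta> :: ('a \<Rightarrow> complex) \<Rightarrow> _)"
proof -
  have "compact_cont (BR_symbol \<delta> :: 'a \<Rightarrow> complex)"
  proof -
    have "(BR_symbol \<delta> :: 'a \<Rightarrow> complex) = BR_power \<delta> z \<delta> 0"
      using BR_symbol_power_times_resolvent[of 1 \<delta> _ z 0] by (intro ext) simp
    then show ?thesis using compact_cont_BR_power[OF z \<delta> \<delta>, of 0] by simp
  qed
  then show ?thesis
    unfolding bochner_riesz_def
    by (metis compact_cont_bounded compact_cont_def Lp_symbol_iff_bounded_on_Lp[OF p])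
qed

lemma Lp_symbol_resolvent_iff:
  "Lp_symbol p (\<lambda>\<xi>::'a::euclidean_space. inverse (z - BR_symbol \<delta> \<xi>)) \<longleftrightarrow>
   bounded_on_Lp p (bochner_riesz_resolvent \<delta> z :: ('a \<Rightarrow> complex) \<Rightarrow> _)"
proof -
  \<comment> \<open>The resolvent symbol is 1 / z outside the ball and so not compactly supported;
    its continuity and bound are read off from r = (1 + m r) / z.\<close>
  have cc: "compact_cont (\<lambda>\<xi>::'a. BR_symbol \<delta> \<xi> * inverse (z - BR_symbol \<delta> \<xi>))"
  proof -
    have "(\<lambda>\<xi>::'a. BR_symbol \<delta> \<xi> * inverse (z - BR_symbol \<delta> \<xi>)) = BR_power \<delta> z \<delta> 1"
      using BR_symbol_power_times_resolvent[of 1 \<delta> _ z 1] by (intro ext) simp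
    then show ?thesis using compact_cont_BR_power[OF z \<delta> \<delta>, of 1] by simp
  qed
  obtain B where B: "\<And>\<xi>::'a. norm (BR_symbol \<delta> \<xi> * inverse (z - BR_symbol \<delta> \<xi>)) \<le> B"
    using compact_cont_bounded[OF cc] by blast
  have eq: "inverse (z - BR_symbol \<delta> \<xi>) = inverse z * (1 + BR_symbol \<delta> \<xi> * inverse (z - BR_symbol \<delta> \<xi>))" for \<xi> :: 'a
    using BR_symbol_neq[of \<xi>] resolvent_point_nonzero by (simp add: field_simps)
  have "continuous_on UNIV (\<lambda>\<xi>::'a. inverse z * (1 + BR_symbol \<delta> \<xi> * inverse (z - BR_symbol \<delta> \<xi>)))"
    using cc unfolding compact_cont_def
    by (intro continuous_on_mult[OF continuous_on_const] continuous_on_add[OF continuous_on_const]) blast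
  then have cont: "continuous_on UNIV (\<lambda>\<xi>::'a. inverse (z - BR_symbol \<delta> \<xi>))"
    unfolding eq[symmetric] .
  have "norm (inverse (z - BR_symbol \<delta> \<xi>)) \<le> norm (inverse z) * (1 + B)" for \<xi> :: 'a
  proof -
    have "norm (1 + BR_symbol \<delta> \<xi> * inverse (z - BR_symbol \<delta> \<xi>)) \<le> 1 + B"
      using norm_triangle_ineq[of 1 "BR_symbol \<delta> \<xi> * inverse (z - BR_symbol \<delta> \<xi>)"] B[of \<xi>] by simp
    then show ?thesis
      by (subst eq, subst norm_mult) (rule mult_left_mono, auto)
  qed
  then show ?thesis
    unfolding bochner_riesz_resolvent_def by (rule Lp_symbol_iff_bounded_on_Lp[OF p cont])
qed

lemma exponent_exists: "\<exists>N::nat. real (2 * d) < real N * \<delta>"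
  using \<delta> reals_Archimedean3 by blast

lemma resolvent_bounded_if_bochner_riesz_bounded:
  assumes m: "Lp_symbol p (BR_symbol \<delta> :: 'a::euclidean_space \<Rightarrow> complex)"
  shows "Lp_symbol p (\<lambda>\<xi>::'a. inverse (z - BR_symbol \<delta> \<xi>))"
proof -
  obtain N :: nat where N: "real (2 * DIM('a)) < real N * \<delta>" using exponent_exists by blast
  then have "N \<noteq> 0" by (intro notI) simp
  have "Lp_symbol p (\<lambda>\<xi>::'a. BR_symbol \<delta> \<xi> ^ n * inverse (z - BR_symbol \<delta> \<xi>))" if "n \<le> N" for n
    using that
  proof (induction n rule: inc_induct)
    case base
    have "(\<lambda>\<xi>::'a. BR_symbol \<delta> \<xi> ^ N * inverse (z - BR_symbol \<delta> \<xi>)) = BR_power \<delta> z (real N * \<delta>) 1"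
      using BR_symbol_power_times_resolvent[OF \<open>N \<noteq> 0\<close>, of \<delta> _ z 1] by auto
    with Lp_symbol_BR_power[OF p z \<delta> N, of 1] show ?case by simp
  next
    case (step n)
    have eq: "BR_symbol \<delta> \<xi> ^ n * inverse (z - BR_symbol \<delta> \<xi>) =
        inverse z * BR_symbol \<delta> \<xi> ^ n + inverse z * (BR_symbol \<delta> \<xi> ^ Suc n * inverse (z - BR_symbol \<delta> \<xi>))" for \<xi> :: 'a
      using BR_symbol_neq[of \<xi>] resolvent_point_nonzero by (simp add: field_simps)
    show ?case
      unfolding eq by (intro Lp_symbol_add Lp_symbol_cmult Lp_symbol_power p m step.IH)
  qed
  from this[of 0] show ?thesis by simp
qed

lemma bochner_riesz_bounded_if_resolvent_bounded:
  assumes r: "Lp_symbol p (\<lambda>\<xi>::'a::euclidean_space. inverse (z - BR_symbol \<delta> \<xi>))"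
  shows "Lp_symbol p (BR_symbol \<delta> :: 'a \<Rightarrow> complex)"
proof -
  let ?r = "\<lambda>\<xi>::'a. inverse (z - BR_symbol \<delta> \<xi>)"
  have mr_eq: "BR_symbol \<delta> \<xi> * ?r \<xi> = z * ?r \<xi> + (- 1)" for \<xi> :: 'a
    using BR_symbol_resolvent[of \<xi>] by (simp add: algebra_simps)
  have mr: "Lp_symbol p (\<lambda>\<xi>::'a. BR_symbol \<delta> \<xi> * ?r \<xi>)"
    unfolding mr_eq by (intro Lp_symbol_add Lp_symbol_cmult Lp_symbol_const p r)
  obtain N :: nat where N: "real (2 * DIM('a)) < real N * \<delta>" using exponent_exists by blast
  also have "\<dots> \<le> real (Suc N) * \<delta>" using \<delta> by simp
  finally have N: "real (2 * DIM('a)) < real (Suc N) * \<delta>" .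
  \<comment> \<open>The exponent of m is one ahead of that of r, so that the descent ends at m
    itself for n = 0.\<close>
  have "Lp_symbol p (\<lambda>\<xi>::'a. BR_symbol \<delta> \<xi> ^ Suc n * ?r \<xi> ^ n)" if "n \<le> N" for n
    using that
  proof (induction n rule: inc_induct)
    case base
    have "(\<lambda>\<xi>::'a. BR_symbol \<delta> \<xi> ^ Suc N * ?r \<xi> ^ N) = BR_power \<delta> z (real (Suc N) * \<delta>) N"
      using BR_symbol_power_times_resolvent[of "Suc N" \<delta> _ z N] by (intro ext) blast
    with Lp_symbol_BR_power[OF p z \<delta> N, of N] show ?case by simp
  next
    case (step n)
    have eq: "BR_symbol \<delta> \<xi> ^ Suc n * ?r \<xi> ^ n =
        z * (BR_symbol \<delta> \<xi> * ?r \<xi>) ^ Suc n + (- 1) * (BR_symbol \<delta> \<xi> ^ Suc (Suc n) * ?r \<xi> ^ Suc n)" for \<xi> :: 'a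
    proof -
      \<comment> \<open>A polynomial identity; the last factor is 1 when a and b are the values of m
        and r.\<close>
      have "z * (a * b) ^ Suc n + (- 1) * (a ^ Suc (Suc n) * b ^ Suc n) = a ^ Suc n * b ^ n * (b * (z - a))"
        for a b :: complex
        by (simp add: power_mult_distrib algebra_simps)
      from this[of "BR_symbol \<delta> \<xi>" "?r \<xi>"] show ?thesis unfolding BR_symbol_resolvent by simp
    qed
    show ?case
      unfolding eq by (intro Lp_symbol_add Lp_symbol_cmult Lp_symbol_power p mr step.IH)
  qed
  from this[of 0] show ?thesis by simp
qed

end

theorem theorem1p1:
  fixes \<delta> p :: real
  assumes "\<delta> > 0" and "1 \<le> p"
  shows
    "(bounded_on_Lp p (bochner_riesz \<delta> :: (real^'d \<Rightarrow> complex) \<Rightarrow> real^'d \<Rightarrow> complex) \<longleftrightarrow>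
      (\<forall>z \<in> UNIV - complex_of_real ` {0..1}.
         bounded_on_Lp p (bochner_riesz_resolvent \<delta> z :: (real^'d \<Rightarrow> complex) \<Rightarrow> real^'d \<Rightarrow> complex)))
     \<and>
     ((\<forall>z \<in> UNIV - complex_of_real ` {0..1}.
         bounded_on_Lp p (bochner_riesz_resolvent \<delta> z :: (real^'d \<Rightarrow> complex) \<Rightarrow> real^'d \<Rightarrow> complex)) \<longleftrightarrow>
      (\<exists>z\<^sub>0 \<in> UNIV - complex_of_real ` {0..1}.
         bounded_on_Lp p (bochner_riesz_resolvent \<delta> z\<^sub>0 :: (real^'d \<Rightarrow> complex) \<Rightarrow> real^'d \<Rightarrow> complex)))"
proof -
  have equiv: "bounded_on_Lp p (bochner_riesz \<delta> :: (real^'d \<Rightarrow> complex) \<Rightarrow> _) \<longleftrightarrow>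
      bounded_on_Lp p (bochner_riesz_resolvent \<delta> z :: (real^'d \<Rightarrow> complex) \<Rightarrow> _)"
    if "z \<in> UNIV - complex_of_real ` {0..1}" for z
  proof -
    from that have z: "z \<notin> complex_of_real ` {0..1}" by simp
    show ?thesis
      unfolding Lp_symbol_BR_symbol_iff[OF assms z, symmetric] Lp_symbol_resolvent_iff[OF assms z, symmetric]
      using resolvent_bounded_if_bochner_riesz_bounded[OF assms z]
        bochner_riesz_bounded_if_resolvent_bounded[OF assms z] by blast
  qed
  \<comment> \<open>Some resolvent point must exist: otherwise (ii) would be vacuous and yield
    neither (i) nor (iii).\<close>
  have "\<i> \<in> UNIV - complex_of_real ` {0..1}" by (auto simp: complex_eq_iff)
  with equiv show ?thesis by blast
qed

end
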